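(* Let $S$ and $T$ be Cu-semigroups, let $J$ be an ideal of $S$, and let $\pi\colon S\to S/J$ denote the quotient map. Then the induced Cu-morphism $\pi^*\colon[\![S/J,T]\!]\to[\![S,T]\!]$ is an order-embedding that identifies $[\![S/J,T]\!]$ with an ideal in $[\![S,T]\!]$. Moreover, $x\in[\![S,T]\!]$ belongs to (the image of) $[\![S/J,T]\!]$ if and only if for some (equivalently, for every) path $(f_\lambda)_\lambda$ in $\mathrm{Cu}[S,T]$ representing $x$, each $f_\lambda$ vanishes on $J$.
   Context: A positively ordered semigroup is a commutative monoid $(S,+,0)$ with a partial order $\le$ compatible with addition such that $0\le a$ for all $a$. For $a,b\in S$, $a\ll b$ (way-below) means: whenever $(c_n)_n$ is an increasing sequence in $S$ whose supremum exists and satisfies $b\le\sup_n c_n$, there is $k$ with $a\le c_k$. A Cu-semigroup is a positively ordered semigroup satisfying: (O1) every increasing sequence has a supremum; (O2) every $a$ is the supremum of a sequence $(a_n)_n$ with $a_n\ll a_{n+1}$ for all $n$; (O3) $a'\ll a$ and $b'\ll b$ imply $a'+b'\ll a+b$; (O4) $\sup_n(a_n+b_n)=\sup_n a_n+\sup_n b_n$ for increasing sequences. A generalized Cu-morphism is a map between Cu-semigroups preserving addition, zero, order and suprema of increasing sequences; a Cu-morphism additionally preserves $\ll$. $\mathrm{Cu}[S,T]$ denotes the set of generalized Cu-morphisms $S\to T$, with pointwise order and addition. A map $f$ is an order-embedding if $f(a)\le f(b)$ iff $a\le b$. An ideal of a Cu-semigroup $S$ is a submonoid $J\subseteq S$ that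 is closed under suprema of increasing sequences and downward-hereditary (if $a\le b$ and $b\in J$ then $a\in J$). For an ideal $J$, write $a\le_J b$ if there is $c\in J$ with $a\le b+c$, and $a\sim_J b$ if $a\le_J b$ and $b\le_J a$; the quotient $S/J=S/{\sim_J}$, with addition and order induced by $+$ and $\le_J$, is a Cu-semigroup and the quotient map $\pi\colon S\to S/J$ is a Cu-morphism. Let $I_{\mathbb Q}=\mathbb Q\cap(0,1)$. For $\varphi,\psi\in\mathrm{Cu}[S,T]$ write $\varphi\prec\psi$ if $\varphi(a')\ll\psi(a)$ whenever $a'\ll a$ in $S$. A path in $\mathrm{Cu}[S,T]$ is a family $\mathbf f=(f_\lambda)_{\lambda\in I_{\mathbb Q}}$ with $f_{\lambda'}\prec f_\lambda$ whenever $\lambda'<\lambda$. Write $\mathbf f\lesssim\mathbf g$ if for every $\lambda$ there is $\mu$ with $f_\lambda\prec g_\mu$. The internal hom $[\![S,T]\!]$ is the set of classes $[\mathbf f]$ of paths modulo ($\mathbf f\lesssim\mathbf g$ and $\mathbf g\lesssim\mathbf f$), with $[\mathbf f]+[\mathbf g]=[(f_\lambda+g_\lambda)_\lambda]$ and $[\mathbf f]\le[\mathbf g]$ iff $\mathbf f\lesssim\mathbf g$; it is a Cu-semigroup. For a Cu-morphism $\pi\colon X\to Y$, $\pi^*\colon[\![Y,T]\!]\to[\![X,T]\!]$ is the Cu-morphism $[(f_\lambda)_\lambda]\mapsto[(f_\lambda\circ\pi)_\lambda]$. *)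

theory Defs
  imports Complex_Main "HOL-Algebra.Group"
begin

record 'a ordered_semigroup = "'a gorder" +
  plus_op :: "'a \<Rightarrow> 'a \<Rightarrow> 'a" (infixl \<open>\<oplus>\<index>\<close> 65)
  zero_op :: 'a (\<open>\<zero>\<index>\<close>)

definition additive :: "('a, 'm) ordered_semigroup_scheme \<Rightarrow> 'a monoid" where
  "additive S = \<lparr>carrier = carrier S, mult = (\<oplus>\<^bsub>S\<^esub>), one = \<zero>\<^bsub>S\<^esub>\<rparr>"

locale pos_ordered_semigroup = partial_order S
  for S :: "('a, 'm) ordered_semigroup_scheme" (structure) +
  assumes additive_comm_monoid: "comm_monoid (additive S)"
    and add_mono_left: "\<lbrakk>a \<in> carrier S; b \<in> carrier S; c \<in> carrier S; a \<sqsubseteq> b\<rbrakk> \<Longrightarrow> a \<oplus> c \<sqsubseteq> b \<oplus> c"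
    and zero_least: "a \<in> carrier S \<Longrightarrow> \<zero> \<sqsubseteq> a"

definition incr_seq :: "('a, 'm) gorder_scheme \<Rightarrow> (nat \<Rightarrow> 'a) \<Rightarrow> bool" where
  "incr_seq S c \<longleftrightarrow> (\<forall>n. c n \<in> carrier S) \<and> (\<forall>n. c n \<sqsubseteq>\<^bsub>S\<^esub> c (Suc n))"

definition is_seq_sup :: "('a, 'm) gorder_scheme \<Rightarrow> (nat \<Rightarrow> 'a) \<Rightarrow> 'a \<Rightarrow> bool" where
  "is_seq_sup S c s \<longleftrightarrow> is_lub S s (range c)"

definition way_below :: "('a, 'm) gorder_scheme \<Rightarrow> 'a \<Rightarrow> 'a \<Rightarrow> bool" where
  "way_below S a b \<longleftrightarrow> a \<in> carrier S \<and> b \<in> carrier S \<and>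
     (\<forall>c s. incr_seq S c \<longrightarrow> is_seq_sup S c s \<longrightarrow> b \<sqsubseteq>\<^bsub>S\<^esub> s \<longrightarrow> (\<exists>k. a \<sqsubseteq>\<^bsub>S\<^esub> c k))"

locale cu_semigroup = pos_ordered_semigroup +
  assumes O1: "incr_seq S c \<Longrightarrow> \<exists>s. is_seq_sup S c s"
    and O2: "a \<in> carrier S \<Longrightarrow> \<exists>c. (\<forall>n. way_below S (c n) (c (Suc n))) \<and> is_seq_sup S c a"
    and O3: "\<lbrakk>way_below S a' a; way_below S b' b\<rbrakk> \<Longrightarrow> way_below S (a' \<oplus> b') (a \<oplus> b)"
    and O4: "\<lbrakk>incr_seq S c; incr_seq S d; is_seq_sup S c s; is_seq_sup S d t\<rbrakk>
               \<Longrightarrow> is_seq_sup S (\<lambda>n. c n \<oplus> d n) (s \<oplus> t)"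

text \<open>Maps are only constrained on the carrier of their domain; their values elsewhere are
  arbitrary, as for \<^const>\<open>hom\<close>.\<close>

definition gen_cu_mor ::
    "('a, 'm) ordered_semigroup_scheme \<Rightarrow> ('b, 'n) ordered_semigroup_scheme \<Rightarrow> ('a \<Rightarrow> 'b) set" where
  "gen_cu_mor S T = {f. f \<in> carrier S \<rightarrow> carrier T \<and>
     (\<forall>a\<in>carrier S. \<forall>b\<in>carrier S. f (a \<oplus>\<^bsub>S\<^esub> b) = f a \<oplus>\<^bsub>T\<^esub> f b) \<and>
     f \<zero>\<^bsub>S\<^esub> = \<zero>\<^bsub>T\<^esub> \<and>
     (\<forall>a\<in>carrier S. \<forall>b\<in>carrier S. a \<sqsubseteq>\<^bsub>S\<^esub> b \<longrightarrow> f a \<sqsubseteq>\<^bsub>T\<^esub> f b) \<and>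
     (\<forall>c s. incr_seq S c \<longrightarrow> is_seq_sup S c s \<longrightarrow> is_seq_sup T (\<lambda>n. f (c n)) (f s))}"

definition cu_mor ::
    "('a, 'm) ordered_semigroup_scheme \<Rightarrow> ('b, 'n) ordered_semigroup_scheme \<Rightarrow> ('a \<Rightarrow> 'b) set" where
  "cu_mor S T = {f \<in> gen_cu_mor S T. \<forall>a b. way_below S a b \<longrightarrow> way_below T (f a) (f b)}"

definition order_embedding ::
    "('a, 'm) gorder_scheme \<Rightarrow> ('b, 'n) gorder_scheme \<Rightarrow> ('a \<Rightarrow> 'b) \<Rightarrow> bool" where
  "order_embedding S T f \<longleftrightarrow> f \<in> carrier S \<rightarrow> carrier T \<and>
     (\<forall>a\<in>carrier S. \<forall>b\<in>carrier S. f a \<sqsubseteq>\<^bsub>T\<^esub> f b \<longleftrightarrow> a \<sqsubseteq>\<^bsub>S\<^esub> b)"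

definition cu_ideal :: "('a, 'm) ordered_semigroup_scheme \<Rightarrow> 'a set \<Rightarrow> bool" where
  "cu_ideal S J \<longleftrightarrow> submonoid J (additive S) \<and>
     (\<forall>c s. incr_seq S c \<longrightarrow> range c \<subseteq> J \<longrightarrow> is_seq_sup S c s \<longrightarrow> s \<in> J) \<and>
     (\<forall>a\<in>carrier S. \<forall>b\<in>J. a \<sqsubseteq>\<^bsub>S\<^esub> b \<longrightarrow> a \<in> J)"

definition ideal_le :: "('a, 'm) ordered_semigroup_scheme \<Rightarrow> 'a set \<Rightarrow> 'a \<Rightarrow> 'a \<Rightarrow> bool" where
  "ideal_le S J a b \<longleftrightarrow> (\<exists>c\<in>J. a \<sqsubseteq>\<^bsub>S\<^esub> b \<oplus>\<^bsub>S\<^esub> c)"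

definition ideal_rel :: "('a, 'm) ordered_semigroup_scheme \<Rightarrow> 'a set \<Rightarrow> ('a \<times> 'a) set" where
  "ideal_rel S J =
     {(a, b). a \<in> carrier S \<and> b \<in> carrier S \<and> ideal_le S J a b \<and> ideal_le S J b a}"

definition quot_map :: "('a, 'm) ordered_semigroup_scheme \<Rightarrow> 'a set \<Rightarrow> 'a \<Rightarrow> 'a set" where
  "quot_map S J a = ideal_rel S J `` {a}"

text \<open>Here and below, an operation on classes is the union, over all representatives, of the
  class of the result; these classes all coincide when the operation is well defined.\<close>

definition cu_quot ::
    "('a, 'm) ordered_semigroup_scheme \<Rightarrow> 'a set \<Rightarrow> 'a set ordered_semigroup" where
  "cu_quot S J =
     \<lparr>carrier = carrier S // ideal_rel S J,
      eq = (=),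
      le = (\<lambda>A B. \<exists>a\<in>A. \<exists>b\<in>B. ideal_le S J a b),
      plus_op = (\<lambda>A B. \<Union>a\<in>A. \<Union>b\<in>B. quot_map S J (a \<oplus>\<^bsub>S\<^esub> b)),
      zero_op = quot_map S J \<zero>\<^bsub>S\<^esub>\<rparr>"

abbreviation I_Q :: "rat set" where
  "I_Q \<equiv> {0<..<1}"

definition mor_prec :: "('a, 'm) gorder_scheme \<Rightarrow> ('b, 'n) gorder_scheme
    \<Rightarrow> ('a \<Rightarrow> 'b) \<Rightarrow> ('a \<Rightarrow> 'b) \<Rightarrow> bool" where
  "mor_prec S T f g \<longleftrightarrow> (\<forall>a' a. way_below S a' a \<longrightarrow> way_below T (f a') (g a))"

definition cu_paths :: "('a, 'm) ordered_semigroup_scheme \<Rightarrow> ('b, 'n) ordered_semigroup_scheme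
    \<Rightarrow> (rat \<Rightarrow> 'a \<Rightarrow> 'b) set" where
  "cu_paths S T = {f. (\<forall>l\<in>I_Q. f l \<in> gen_cu_mor S T) \<and>
     (\<forall>l'\<in>I_Q. \<forall>l\<in>I_Q. l' < l \<longrightarrow> mor_prec S T (f l') (f l))}"

definition path_le :: "('a, 'm) gorder_scheme \<Rightarrow> ('b, 'n) gorder_scheme
    \<Rightarrow> (rat \<Rightarrow> 'a \<Rightarrow> 'b) \<Rightarrow> (rat \<Rightarrow> 'a \<Rightarrow> 'b) \<Rightarrow> bool" where
  "path_le S T f g \<longleftrightarrow> (\<forall>l\<in>I_Q. \<exists>m\<in>I_Q. mor_prec S T (f l) (g m))"

definition path_rel :: "('a, 'm) ordered_semigroup_scheme \<Rightarrow> ('b, 'n) ordered_semigroup_scheme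
    \<Rightarrow> ((rat \<Rightarrow> 'a \<Rightarrow> 'b) \<times> (rat \<Rightarrow> 'a \<Rightarrow> 'b)) set" where
  "path_rel S T =
     {(f, g). f \<in> cu_paths S T \<and> g \<in> cu_paths S T \<and> path_le S T f g \<and> path_le S T g f}"

text \<open>Paths that agree for indices in \<^const>\<open>I_Q\<close> and on the carrier of \<open>S\<close> lie in the same class, so
  irrelevant values of a representing family do not affect the class.\<close>

definition path_class :: "('a, 'm) ordered_semigroup_scheme \<Rightarrow> ('b, 'n) ordered_semigroup_scheme
    \<Rightarrow> (rat \<Rightarrow> 'a \<Rightarrow> 'b) \<Rightarrow> (rat \<Rightarrow> 'a \<Rightarrow> 'b) set" where
  "path_class S T f = path_rel S T `` {f}"

definition internal_hom :: "('a, 'm) ordered_semigroup_scheme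
    \<Rightarrow> ('b, 'n) ordered_semigroup_scheme \<Rightarrow> (rat \<Rightarrow> 'a \<Rightarrow> 'b) set ordered_semigroup" where
  "internal_hom S T =
     \<lparr>carrier = cu_paths S T // path_rel S T,
      eq = (=),
      le = (\<lambda>F G. \<exists>f\<in>F. \<exists>g\<in>G. path_le S T f g),
      plus_op = (\<lambda>F G. \<Union>f\<in>F. \<Union>g\<in>G. path_class S T (\<lambda>l a. f l a \<oplus>\<^bsub>T\<^esub> g l a)),
      zero_op = path_class S T (\<lambda>l a. \<zero>\<^bsub>T\<^esub>)\<rparr>"

definition hom_pullback :: "('a, 'm) ordered_semigroup_scheme
    \<Rightarrow> ('c, 'n) ordered_semigroup_scheme \<Rightarrow> ('a \<Rightarrow> 'b)
    \<Rightarrow> (rat \<Rightarrow> 'b \<Rightarrow> 'c) set \<Rightarrow> (rat \<Rightarrow> 'a \<Rightarrow> 'c) set" where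
  "hom_pullback X T p F = (\<Union>f\<in>F. path_class X T (\<lambda>l. f l \<circ> p))"

definition quot_pullback :: "('a, 'm) ordered_semigroup_scheme
    \<Rightarrow> 'a set \<Rightarrow> ('b, 'n) ordered_semigroup_scheme
    \<Rightarrow> (rat \<Rightarrow> 'a set \<Rightarrow> 'b) set \<Rightarrow> (rat \<Rightarrow> 'a \<Rightarrow> 'b) set" where
  "quot_pullback S J T = hom_pullback S T (quot_map S J)"

definition vanishes_on :: "('b, 'n) ordered_semigroup_scheme \<Rightarrow> 'a set \<Rightarrow> ('a \<Rightarrow> 'b) \<Rightarrow> bool" where
  "vanishes_on T J f \<longleftrightarrow> (\<forall>a\<in>J. f a = \<zero>\<^bsub>T\<^esub>)"

end

theory Submission
  imports Defs
begin

text \<open>A path pulled back along \<open>\<pi>\<close> vanishes on \<open>J\<close>, and conversely a path vanishing on \<open>J\<close> descends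
  to \<open>S/J\<close>, because increasing sequences in \<open>S/J\<close> lift to \<open>S\<close>; moreover \<open>\<prec>\<close> can be tested on
  pullbacks because \<open>\<pi>\<close> is a Cu-morphism and way-below pairs in \<open>S/J\<close> are dominated by images of
  way-below pairs in \<open>S\<close>. So the image of \<open>\<pi>\<^sup>*\<close> is the set of classes of vanishing paths. It is
  downward hereditary since \<open>f \<prec> g\<close> forces \<open>f \<le> g\<close> pointwise, and closed under suprema
  since every member of a path representing the supremum of a sequence of paths can be taken to be
  a member of one of these paths. Way-below is preserved because \<open>x \<lless> [g]\<close> holds
  iff \<open>x\<close> is at most the class of a truncation \<open>\<lambda> \<mapsto> g (\<mu>\<lambda>)\<close> with
  \<open>\<mu> < 1\<close>, and truncation commutes with pulling back.\<close>

section \<open>Cu-semigroups and generalized Cu-morphisms\<close>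

text \<open>\<open>Upper\<close> compares only with those members of a set that lie in the carrier;
  for a sequence inside the carrier this restriction disappears.\<close>

lemma is_seq_sup_iff:
  assumes "\<And>n. c n \<in> carrier S"
  shows "is_seq_sup S c s \<longleftrightarrow> s \<in> carrier S \<and> (\<forall>n. c n \<sqsubseteq>\<^bsub>S\<^esub> s) \<and>
    (\<forall>u\<in>carrier S. (\<forall>n. c n \<sqsubseteq>\<^bsub>S\<^esub> u) \<longrightarrow> s \<sqsubseteq>\<^bsub>S\<^esub> u)"
  using assms by (auto simp: is_seq_sup_def least_def Upper_def)

lemma incr_seq_carrier: "incr_seq S c \<Longrightarrow> c n \<in> carrier S"
  by (simp add: incr_seq_def)

lemma incr_seq_Suc: "incr_seq S c \<Longrightarrow> c n \<sqsubseteq>\<^bsub>S\<^esub> c (Suc n)"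
  by (simp add: incr_seq_def)

lemma
  assumes "incr_seq S c" "is_seq_sup S c s"
  shows seq_sup_carrier: "s \<in> carrier S"
    and seq_sup_upper: "c n \<sqsubseteq>\<^bsub>S\<^esub> s"
    and seq_sup_least: "\<lbrakk>u \<in> carrier S; \<And>n. c n \<sqsubseteq>\<^bsub>S\<^esub> u\<rbrakk> \<Longrightarrow> s \<sqsubseteq>\<^bsub>S\<^esub> u"
  using assms is_seq_sup_iff[of c S s] by (auto simp: incr_seq_def)

lemma is_seq_supI:
  assumes "incr_seq S c" "s \<in> carrier S" "\<And>n. c n \<sqsubseteq>\<^bsub>S\<^esub> s"
    "\<And>u. \<lbrakk>u \<in> carrier S; \<And>n. c n \<sqsubseteq>\<^bsub>S\<^esub> u\<rbrakk> \<Longrightarrow> s \<sqsubseteq>\<^bsub>S\<^esub> u"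
  shows "is_seq_sup S c s"
  using assms is_seq_sup_iff[of c S s] by (auto simp: incr_seq_def)

lemma
  assumes "way_below S a b"
  shows way_below_carrier_left: "a \<in> carrier S" and way_below_carrier_right: "b \<in> carrier S"
  using assms by (simp_all add: way_below_def)

lemma way_belowD:
  "\<lbrakk>way_below S a b; incr_seq S c; is_seq_sup S c s; b \<sqsubseteq>\<^bsub>S\<^esub> s\<rbrakk> \<Longrightarrow> \<exists>k. a \<sqsubseteq>\<^bsub>S\<^esub> c k"
  by (simp add: way_below_def)

lemma way_belowI:
  "\<lbrakk>a \<in> carrier S; b \<in> carrier S;
    \<And>c s. \<lbrakk>incr_seq S c; is_seq_sup S c s; b \<sqsubseteq>\<^bsub>S\<^esub> s\<rbrakk> \<Longrightarrow> \<exists>k. a \<sqsubseteq>\<^bsub>S\<^esub> c k\<rbrakk> \<Longrightarrow> way_below S a b"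
  by (simp add: way_below_def)

context pos_ordered_semigroup
begin

lemma plus_closed [simp]: "\<lbrakk>a \<in> carrier S; b \<in> carrier S\<rbrakk> \<Longrightarrow> a \<oplus> b \<in> carrier S"
  using monoid.m_closed[OF comm_monoid.axioms(1)[OF additive_comm_monoid]]
  by (simp add: additive_def)

lemma zero_closed [simp]: "\<zero> \<in> carrier S"
  using monoid.one_closed[OF comm_monoid.axioms(1)[OF additive_comm_monoid]]
  by (simp add: additive_def)

lemma plus_zero [simp]: "a \<in> carrier S \<Longrightarrow> a \<oplus> \<zero> = a"
  using monoid.r_one[OF comm_monoid.axioms(1)[OF additive_comm_monoid]]
  by (simp add: additive_def)

lemma plus_assoc:
  "\<lbrakk>a \<in> carrier S; b \<in> carrier S; c \<in> carrier S\<rbrakk> \<Longrightarrow> a \<oplus> b \<oplus> c = a \<oplus> (b \<oplus> c)"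
  using monoid.m_assoc[OF comm_monoid.axioms(1)[OF additive_comm_monoid]]
  by (simp add: additive_def)

lemma plus_comm: "\<lbrakk>a \<in> carrier S; b \<in> carrier S\<rbrakk> \<Longrightarrow> a \<oplus> b = b \<oplus> a"
  using comm_monoid.m_comm[OF additive_comm_monoid] by (simp add: additive_def)

lemma plus_left_comm:
  "\<lbrakk>a \<in> carrier S; b \<in> carrier S; c \<in> carrier S\<rbrakk> \<Longrightarrow> a \<oplus> (b \<oplus> c) = b \<oplus> (a \<oplus> c)"
  by (metis plus_assoc plus_comm)

lemmas plus_ac = plus_assoc plus_comm plus_left_comm

lemma zero_plus [simp]: "a \<in> carrier S \<Longrightarrow> \<zero> \<oplus> a = a"
  by (metis plus_comm plus_zero zero_closed)

lemma add_mono: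
  assumes "a \<in> carrier S" "b \<in> carrier S" "c \<in> carrier S" "d \<in> carrier S" "a \<sqsubseteq> b" "c \<sqsubseteq> d"
  shows "a \<oplus> c \<sqsubseteq> b \<oplus> d"
proof -
  have "a \<oplus> c \<sqsubseteq> b \<oplus> c"
    using assms by (simp add: add_mono_left)
  moreover have "b \<oplus> c \<sqsubseteq> b \<oplus> d"
    using add_mono_left[of c d b] assms by (simp add: plus_comm)
  ultimately show ?thesis
    using assms le_trans[of "a \<oplus> c" "b \<oplus> c" "b \<oplus> d"] by simp
qed

lemma le_plus_right: "\<lbrakk>a \<in> carrier S; b \<in> carrier S\<rbrakk> \<Longrightarrow> a \<sqsubseteq> a \<oplus> b"
  using add_mono[of a a \<zero> b] by (simp add: zero_least)

lemma le_plus_left: "\<lbrakk>a \<in> carrier S; b \<in> carrier S\<rbrakk> \<Longrightarrow> b \<sqsubseteq> a \<oplus> b"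
  using le_plus_right[of b a] by (simp add: plus_comm)

lemma incr_seq_const: "a \<in> carrier S \<Longrightarrow> incr_seq S (\<lambda>_. a)"
  by (simp add: incr_seq_def)

lemma seq_sup_const: "a \<in> carrier S \<Longrightarrow> is_seq_sup S (\<lambda>_. a) a"
  by (intro is_seq_supI incr_seq_const) auto

lemma seq_sup_unique:
  assumes "incr_seq S c" "is_seq_sup S c s" "is_seq_sup S c t"
  shows "s = t"
  using assms seq_sup_least[of S c s t] seq_sup_least[of S c t s]
  by (intro le_antisym) (simp_all add: seq_sup_carrier seq_sup_upper)

lemma incr_seq_plus: "\<lbrakk>incr_seq S c; incr_seq S d\<rbrakk> \<Longrightarrow> incr_seq S (\<lambda>n. c n \<oplus> d n)"
  by (simp add: incr_seq_def add_mono)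

lemma way_below_le: "way_below S a b \<Longrightarrow> a \<sqsubseteq> b"
  using way_belowD[of S a b "\<lambda>_. b" b]
  by (auto simp: incr_seq_const seq_sup_const way_below_carrier_right)

lemma way_below_le_trans:
  assumes "way_below S a b" "b \<sqsubseteq> c" "c \<in> carrier S"
  shows "way_below S a c"
proof (rule way_belowI)
  fix d s assume "incr_seq S d" "is_seq_sup S d s" "c \<sqsubseteq> s"
  moreover from this have "b \<sqsubseteq> s"
    using assms by (meson le_trans seq_sup_carrier way_below_carrier_right)
  ultimately show "\<exists>k. a \<sqsubseteq> d k"
    using assms(1) way_belowD by metis
qed (use assms in \<open>auto dest: way_below_carrier_left\<close>)

lemma le_way_below_trans:
  assumes "a \<sqsubseteq> b" "way_below S b c" "a \<in> carrier S"
  shows "way_below S a c"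
proof (rule way_belowI)
  fix d s assume "incr_seq S d" "is_seq_sup S d s" "c \<sqsubseteq> s"
  then obtain k where "b \<sqsubseteq> d k" "d k \<in> carrier S"
    using assms(2) way_belowD incr_seq_carrier by metis
  then show "\<exists>k. a \<sqsubseteq> d k"
    using assms by (meson le_trans way_below_carrier_left)
qed (use assms in \<open>auto dest: way_below_carrier_right\<close>)

lemma way_below_trans: "\<lbrakk>way_below S a b; way_below S b c\<rbrakk> \<Longrightarrow> way_below S a c"
  by (meson way_below_le way_below_le_trans way_below_carrier_right)

lemma way_below_zero: "way_below S \<zero> \<zero>"
  by (rule way_belowI) (auto simp: zero_least incr_seq_carrier)

end

context cu_semigroup
begin

text \<open>The sequence from O2 is increasing because way-below implies below, and each term is way
  below \<open>a\<close> through its successor.\<close>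

lemma way_below_approx:
  assumes "a \<in> carrier S"
  obtains c where "incr_seq S c" "\<And>n. way_below S (c n) (c (Suc n))" "is_seq_sup S c a"
    "\<And>n. way_below S (c n) a"
proof -
  obtain c where c: "\<forall>n. way_below S (c n) (c (Suc n))" "is_seq_sup S c a"
    using O2[OF assms] by (elim exE conjE)
  then have i: "incr_seq S c"
    by (auto simp: incr_seq_def way_below_le dest: way_below_carrier_left)
  moreover have "way_below S (c n) a" for n
    using c(1) seq_sup_upper[OF i c(2), of n] way_below_le_trans[of "c n" "c (Suc n)" a]
      seq_sup_upper[OF i c(2), of "Suc n"] assms by simp
  ultimately show thesis using that[of c] c by simp
qed

text \<open>Once \<open>a\<close> lies below a term \<open>c k\<close> of a rapidly increasing
  sequence with supremum \<open>b\<close>, the next term interpolates.\<close>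

lemma way_below_interpolate:
  assumes "way_below S a b"
  obtains x where "way_below S a x" "way_below S x b"
proof -
  obtain c where c: "incr_seq S c" "\<And>n. way_below S (c n) (c (Suc n))" "is_seq_sup S c b"
    "\<And>n. way_below S (c n) b"
    using way_below_approx[OF way_below_carrier_right[OF assms]] by metis
  then obtain k where "a \<sqsubseteq> c k"
    using way_belowD[OF assms c(1,3)] way_below_carrier_right[OF assms] by auto
  then have "way_below S a (c (Suc k))"
    using c(2) le_way_below_trans way_below_carrier_left[OF assms] by blast
  then show thesis using that c(4) by blast
qed

end

lemma gen_cu_morD:
  assumes "f \<in> gen_cu_mor S T"
  shows gen_cu_mor_closed: "a \<in> carrier S \<Longrightarrow> f a \<in> carrier T"
    and gen_cu_mor_plus: "\<lbrakk>a \<in> carrier S; b \<in> carrier S\<rbrakk> \<Longrightarrow> f (a \<oplus>\<^bsub>S\<^esub> b) = f a \<oplus>\<^bsub>T\<^esub> f b"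
    and gen_cu_mor_zero: "f \<zero>\<^bsub>S\<^esub> = \<zero>\<^bsub>T\<^esub>"
    and gen_cu_mor_mono: "\<lbrakk>a \<in> carrier S; b \<in> carrier S; a \<sqsubseteq>\<^bsub>S\<^esub> b\<rbrakk> \<Longrightarrow> f a \<sqsubseteq>\<^bsub>T\<^esub> f b"
    and gen_cu_mor_sup: "\<lbrakk>incr_seq S c; is_seq_sup S c s\<rbrakk> \<Longrightarrow> is_seq_sup T (\<lambda>n. f (c n)) (f s)"
  using assms unfolding gen_cu_mor_def by blast+

lemma gen_cu_morI:
  assumes "\<And>a. a \<in> carrier S \<Longrightarrow> f a \<in> carrier T"
    "\<And>a b. \<lbrakk>a \<in> carrier S; b \<in> carrier S\<rbrakk> \<Longrightarrow> f (a \<oplus>\<^bsub>S\<^esub> b) = f a \<oplus>\<^bsub>T\<^esub> f b"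
    "f \<zero>\<^bsub>S\<^esub> = \<zero>\<^bsub>T\<^esub>"
    "\<And>a b. \<lbrakk>a \<in> carrier S; b \<in> carrier S; a \<sqsubseteq>\<^bsub>S\<^esub> b\<rbrakk> \<Longrightarrow> f a \<sqsubseteq>\<^bsub>T\<^esub> f b"
    "\<And>c s. \<lbrakk>incr_seq S c; is_seq_sup S c s\<rbrakk> \<Longrightarrow> is_seq_sup T (\<lambda>n. f (c n)) (f s)"
  shows "f \<in> gen_cu_mor S T"
  using assms unfolding gen_cu_mor_def by blast

lemma gen_cu_mor_incr_seq:
  "\<lbrakk>f \<in> gen_cu_mor S T; incr_seq S c\<rbrakk> \<Longrightarrow> incr_seq T (\<lambda>n. f (c n))"
  unfolding incr_seq_def by (blast intro: gen_cu_mor_closed gen_cu_mor_mono)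

lemma gen_cu_mor_comp:
  assumes f: "f \<in> gen_cu_mor S T" and g: "g \<in> gen_cu_mor T U"
  shows "g \<circ> f \<in> gen_cu_mor S U"
  by (rule gen_cu_morI)
    (simp_all add: gen_cu_morD[OF f] gen_cu_morD[OF g] gen_cu_mor_incr_seq[OF f])

section \<open>Suprema and the way-below relation in the internal hom\<close>

lemma I_Q_above:
  assumes "m \<in> I_Q" "m' \<in> I_Q"
  obtains n where "n \<in> I_Q" "m < n" "m' < n"
proof
  show "(max m m' + 1) / 2 \<in> I_Q" "m < (max m m' + 1) / 2" "m' < (max m m' + 1) / 2"
    using assms by (auto simp: max_def)
qed

lemma I_Q_mult: "\<lbrakk>m \<in> I_Q; n \<in> I_Q\<rbrakk> \<Longrightarrow> m * n \<in> I_Q"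
  using mult_strict_mono[of m 1 n 1] by simp

text \<open>The affine rescaling that squeezes \<open>I_Q\<close> between two chosen levels; the
  gluing construction places its pieces with it.\<close>

lemma I_Q_convex:
  assumes "m \<in> I_Q" "n \<in> I_Q" "m < n" "l \<in> I_Q"
  shows "m + (n - m) * l \<in> {m<..<n}"
proof -
  have "0 < (n - m) * l" "(n - m) * l < (n - m) * 1"
    using assms by (intro mult_pos_pos mult_strict_left_mono; simp)+
  then show ?thesis by auto
qed

text \<open>A cofinal sequence in \<open>I_Q\<close> increasing to 1. The shift by 2 makes it start
  at 1/2, so that no term is 0.\<close>

definition cut_point :: "nat \<Rightarrow> rat" where
  "cut_point k = 1 - 1 / (of_nat k + 2)"

lemma cut_point_I_Q: "cut_point k \<in> I_Q"
  by (simp add: cut_point_def field_simps)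

lemma cut_point_strict_mono: "m < n \<Longrightarrow> cut_point m < cut_point n"
  by (simp add: cut_point_def field_simps)

text \<open>The Archimedean property bounds \<open>1 / (1 - l)\<close>. The extra demand
  \<open>n \<le> k\<close> lets the gluing construction also get past the index of a given
  family.\<close>

lemma cut_point_exceeds:
  assumes "l \<in> I_Q"
  obtains k where "n \<le> k" "l < cut_point k"
proof -
  obtain j :: nat where j: "1 / (1 - l) < of_nat j"
    using reals_Archimedean2 by blast
  have "1 / (1 - l) < of_nat (max n j) + 2"
    using j by (simp add: of_nat_max max_def split: if_splits)
  then have "1 < (of_nat (max n j) + 2) * (1 - l)"
    using assms by (simp add: field_simps)
  then have "1 / (of_nat (max n j) + 2) < 1 - l"
    by (simp add: pos_divide_less_eq mult.commute add_nonneg_pos)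
  then have "l < cut_point (max n j)"
    by (simp add: cut_point_def)
  then show thesis using that[of "max n j"] by simp
qed

text \<open>Choose levels \<open>v k \<le> u k\<close> such that the family \<open>F k\<close> at \<open>u k\<close> lies below \<open>F (Suc k)\<close> at
  \<open>v (Suc k)\<close>, and squeeze the piece of \<open>F k\<close> between \<open>v k\<close> and \<open>u k\<close> into the \<open>k\<close>-th of countably
  many consecutive intervals exhausting \<open>I_Q\<close>.\<close>

lemma glue_increasing_families:
  fixes F :: "nat \<Rightarrow> rat \<Rightarrow> 'x" and R :: "'x \<Rightarrow> 'x \<Rightarrow> bool"
  assumes trans: "\<And>x y z. \<lbrakk>R x y; R y z\<rbrakk> \<Longrightarrow> R x z"
    and path: "\<And>n l l'. \<lbrakk>l \<in> I_Q; l' \<in> I_Q; l < l'\<rbrakk> \<Longrightarrow> R (F n l) (F n l')"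
    and le: "\<And>n l. l \<in> I_Q \<Longrightarrow> \<exists>m\<in>I_Q. R (F n l) (F (Suc n) m)"
  shows "\<exists>h. (\<forall>l\<in>I_Q. \<exists>n. \<exists>m\<in>I_Q. h l = F n m) \<and>
    (\<forall>l\<in>I_Q. \<forall>l'\<in>I_Q. l < l' \<longrightarrow> R (h l) (h l')) \<and>
    (\<forall>n. \<forall>l\<in>I_Q. \<exists>m\<in>I_Q. R (F n l) (h m))"
proof -
  \<comment> \<open>The midpoint of \<open>w\<close> and 1 puts \<open>u k w\<close> strictly above
    \<open>w\<close>; the maximum with \<open>cut_point k\<close> makes the upper levels exhaust
    \<open>I_Q\<close> as \<open>k\<close> grows.\<close>
  define u where "u k w = max ((w + 1) / 2) (cut_point k)" for k w
  have u: "u k w \<in> I_Q" "w < u k w" "cut_point k \<le> u k w" if "w \<in> I_Q" for k w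
    using that cut_point_I_Q[of k] by (auto simp: u_def max_def)
  have le_all: "\<exists>m\<in>I_Q. R (F j l) (F k m)" if "j \<le> k" "l \<in> I_Q" for j k l
    using that(1)
  proof (induction k rule: dec_induct)
    case base
    then show ?case using path[OF that(2)] I_Q_above[OF that(2) that(2)] by metis
  next
    case (step k)
    then show ?case using le trans by metis
  qed
  \<comment> \<open>Finitely many families are dominated at once by passing to a level above those
    found for each of them.\<close>
  have bound: "\<exists>w\<in>I_Q. \<forall>j\<le>i. R (F j l) (F k w)" if l: "l \<in> I_Q" and "i \<le> k" for i k l
    using \<open>i \<le> k\<close>
  proof (induction i)
    case 0
    then show ?case using le_all[OF _ l] by auto
  next
    case (Suc i)
    then obtain w where w: "w \<in> I_Q" "\<forall>j\<le>i. R (F j l) (F k w)" by auto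
    obtain m where m: "m \<in> I_Q" "R (F (Suc i) l) (F k m)"
      using le_all[OF \<open>Suc i \<le> k\<close> l] by blast
    obtain n where n: "n \<in> I_Q" "w < n" "m < n" using I_Q_above[OF w(1) m(1)] .
    have "\<forall>j\<le>Suc i. R (F j l) (F k n)"
      using w m n path trans by (metis le_Suc_eq)
    then show ?case using n(1) by blast
  qed
  \<comment> \<open>Dependent choice of the starting levels. The condition ranges over all
    \<open>j \<le> k\<close>, so that members of earlier families are caught as well as those of
    \<open>F k\<close>.\<close>
  have "\<exists>v. \<forall>k. v k \<in> I_Q \<and> (\<forall>j\<le>k. R (F j (u k (v k))) (F (Suc k) (v (Suc k))))"
  proof (rule dependent_nat_choice)
    show "\<exists>w. w \<in> I_Q" using cut_point_I_Q by blast
    fix w k assume "w \<in> I_Q"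
    then show "\<exists>w'. w' \<in> I_Q \<and> (\<forall>j\<le>k. R (F j (u k w)) (F (Suc k) w'))"
      using bound[of "u k w" k "Suc k"] u by auto
  qed
  then obtain v where vI: "\<And>k. v k \<in> I_Q"
    and v: "\<And>j k. j \<le> k \<Longrightarrow> R (F j (u k (v k))) (F (Suc k) (v (Suc k)))" by blast
  define r where "r k l = v k + (u k (v k) - v k) * l" for k l
  have r: "v k < r k l" "r k l < u k (v k)" "r k l \<in> I_Q" if "l \<in> I_Q" for k l
    using I_Q_convex[OF vI[of k] u(1)[OF vI, of k k] u(2)[OF vI, of k k] that]
      u(1)[OF vI, of k k] vI[of k]
    unfolding r_def greaterThanLessThan_iff by linarith+
  have r_mono: "r k l < r k l'" if "l < l'" for k l l'
    using that u(2)[OF vI] by (simp add: r_def)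
  have up: "R (F k (u k (v k))) (F k' (v k'))" if "k < k'" for k k'
    using that
  proof (induction rule: less_Suc_induct)
    case (1 i)
    show ?case by (rule v) simp
  next
    case (2 i j k)
    then show ?case using path[OF vI u(1)[OF vI] u(2)[OF vI], of j] trans by blast
  qed
  \<comment> \<open>On \<open>I_Q\<close>, \<open>piece l\<close> equals \<open>n\<close> exactly
    when \<open>1 - 1/n \<le> l < 1 - 1/(n+1)\<close>, so the breaks are the points
    \<open>cut_point k\<close>.\<close>
  define piece :: "rat \<Rightarrow> nat" where "piece l = nat \<lfloor>1 / (1 - l)\<rfloor>" for l
  define h where "h l = F (piece l) (r (piece l) l)" for l
  have piece_mono: "piece l \<le> piece l'" if "l \<le> l'" "l' \<in> I_Q" for l l'
    unfolding piece_def using that by (intro nat_mono floor_mono divide_left_mono) auto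
  have piece_cut: "piece (cut_point k) = k + 2" for k
  proof -
    have "1 / (1 - cut_point k) = of_nat (k + 2)"
      by (simp add: cut_point_def)
    then show ?thesis unfolding piece_def by (metis floor_of_nat nat_int)
  qed
  show ?thesis
  proof (intro exI[of _ h] conjI ballI allI impI)
    fix l assume "l \<in> I_Q"
    then show "\<exists>n. \<exists>m\<in>I_Q. h l = F n m" unfolding h_def using r(3) by blast
  next
    fix l l' :: rat assume l: "l \<in> I_Q" "l' \<in> I_Q" "l < l'"
    show "R (h l) (h l')"
    proof (cases "piece l = piece l'")
      case True
      then show ?thesis unfolding h_def using l r(3) r_mono by (auto intro!: path)
    next
      case False
      \<comment> \<open>Climb within the earlier family to its upper level, cross to the lower level
        of the later family, then climb there.\<close>
      then have "R (F (piece l) (u (piece l) (v (piece l)))) (F (piece l') (v (piece l')))"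
        using piece_mono[of l l'] l by (intro up) auto
      moreover have "R (h l) (F (piece l) (u (piece l) (v (piece l))))"
        unfolding h_def using l r u(1)[OF vI] by (intro path) auto
      moreover have "R (F (piece l') (v (piece l'))) (h l')"
        unfolding h_def using l r vI by (intro path) auto
      ultimately show ?thesis using trans by blast
    qed
  next
    fix n and l :: rat assume l: "l \<in> I_Q"
    obtain k where k: "n \<le> k" "l < cut_point k" using cut_point_exceeds[OF l] .
    have "R (F n l) (F n (u k (v k)))"
      using less_le_trans[OF k(2) u(3)[OF vI]] l by (intro path u(1) vI)
    moreover have "R (F n (u k (v k))) (F (Suc k) (v (Suc k)))" using v[OF k(1)] .
    \<comment> \<open>The point \<open>cut_point k\<close> belongs to interval \<open>k + 2\<close>,
      so one more family has to be crossed.\<close>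
    moreover have "R (F (Suc k) (v (Suc k))) (F (k + 2) (v (k + 2)))"
      by (rule trans[OF path[OF vI u(1)[OF vI] u(2)[OF vI]] up]) simp
    moreover have "R (F (k + 2) (v (k + 2))) (h (cut_point k))"
      unfolding h_def piece_cut using r[OF cut_point_I_Q] vI by (intro path) auto
    ultimately show "\<exists>m\<in>I_Q. R (F n l) (h m)"
      using trans cut_point_I_Q by blast
  qed
qed

section \<open>Paths and the relation \<prec> between morphisms\<close>

lemma mor_precI:
  "(\<And>a' a. way_below S a' a \<Longrightarrow> way_below T (f a') (g a)) \<Longrightarrow> mor_prec S T f g"
  by (simp add: mor_prec_def)

lemma mor_precD: "\<lbrakk>mor_prec S T f g; way_below S a' a\<rbrakk> \<Longrightarrow> way_below T (f a') (g a)"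
  by (simp add: mor_prec_def)

lemma cu_pathsI:
  "\<lbrakk>\<And>l. l \<in> I_Q \<Longrightarrow> f l \<in> gen_cu_mor S T;
    \<And>l' l. \<lbrakk>l' \<in> I_Q; l \<in> I_Q; l' < l\<rbrakk> \<Longrightarrow> mor_prec S T (f l') (f l)\<rbrakk> \<Longrightarrow> f \<in> cu_paths S T"
  by (simp add: cu_paths_def)

lemma
  assumes "f \<in> cu_paths S T"
  shows cu_paths_mor: "l \<in> I_Q \<Longrightarrow> f l \<in> gen_cu_mor S T"
    and cu_paths_prec: "\<lbrakk>l' \<in> I_Q; l \<in> I_Q; l' < l\<rbrakk> \<Longrightarrow> mor_prec S T (f l') (f l)"
  using assms by (simp_all add: cu_paths_def)

lemma path_leI:
  "(\<And>l. l \<in> I_Q \<Longrightarrow> \<exists>m\<in>I_Q. mor_prec S T (f l) (g m)) \<Longrightarrow> path_le S T f g"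
  by (simp add: path_le_def)

lemma path_leE:
  assumes "path_le S T f g" "l \<in> I_Q"
  obtains m where "m \<in> I_Q" "mor_prec S T (f l) (g m)"
  using assms unfolding path_le_def by blast

text \<open>A morphism need not satisfy \<open>mor_prec\<close> with itself, so each index is
  compared with a strictly larger one.\<close>

lemma path_le_refl: "f \<in> cu_paths S T \<Longrightarrow> path_le S T f f"
  by (meson I_Q_above cu_paths_prec path_leI)

lemma internal_hom_carrier: "carrier (internal_hom S T) = path_class S T ` cu_paths S T"
  by (auto simp: internal_hom_def quotient_def path_class_def)

lemma internal_hom_carrierE:
  assumes "x \<in> carrier (internal_hom S T)"
  obtains f where "f \<in> cu_paths S T" "x = path_class S T f"
  using assms unfolding internal_hom_carrier by blast

locale cu_pair = S: cu_semigroup S + T: cu_semigroup T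
  for S :: "('a, 'm) ordered_semigroup_scheme" and T :: "('b, 'n) ordered_semigroup_scheme"
begin

text \<open>Interpolating \<open>a' \<lless> x \<lless> a\<close> gives
  \<open>f a' \<lless> g x \<lless> h a\<close>.\<close>

lemma mor_prec_trans:
  assumes "mor_prec S T f g" "mor_prec S T g h"
  shows "mor_prec S T f h"
proof (rule mor_precI)
  fix a' a assume "way_below S a' a"
  then obtain x where "way_below S a' x" "way_below S x a"
    by (rule S.way_below_interpolate)
  then show "way_below T (f a') (h a)"
    using assms mor_precD T.way_below_trans by metis
qed

text \<open>Write \<open>a\<close> as a supremum of elements \<open>c n \<lless> a\<close>: each
  \<open>f (c n)\<close> is below \<open>g a\<close>, and \<open>f\<close> preserves the
  supremum.\<close>

lemma mor_prec_le:
  assumes f: "f \<in> gen_cu_mor S T" and g: "g \<in> gen_cu_mor S T"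
    and fg: "mor_prec S T f g" and a: "a \<in> carrier S"
  shows "f a \<sqsubseteq>\<^bsub>T\<^esub> g a"
proof -
  obtain c where c: "incr_seq S c" "is_seq_sup S c a" "\<And>n. way_below S (c n) a"
    using S.way_below_approx[OF a] by metis
  have "f (c n) \<sqsubseteq>\<^bsub>T\<^esub> g a" for n
    by (rule T.way_below_le[OF mor_precD[OF fg c(3)]])
  then show ?thesis
    using seq_sup_least[OF gen_cu_mor_incr_seq[OF f c(1)] gen_cu_mor_sup[OF f c(1,2)]]
      gen_cu_mor_closed[OF g a] by blast
qed

lemma zero_gen_cu_mor: "(\<lambda>_. \<zero>\<^bsub>T\<^esub>) \<in> gen_cu_mor S T"
  by (rule gen_cu_morI) (simp_all add: T.seq_sup_const)

lemma plus_gen_cu_mor: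
  assumes f: "f \<in> gen_cu_mor S T" and g: "g \<in> gen_cu_mor S T"
  shows "(\<lambda>a. f a \<oplus>\<^bsub>T\<^esub> g a) \<in> gen_cu_mor S T"
proof (rule gen_cu_morI)
  fix c s assume c: "incr_seq S c" "is_seq_sup S c s"
  show "is_seq_sup T (\<lambda>n. f (c n) \<oplus>\<^bsub>T\<^esub> g (c n)) (f s \<oplus>\<^bsub>T\<^esub> g s)"
    by (rule T.O4[OF gen_cu_mor_incr_seq[OF f c(1)] gen_cu_mor_incr_seq[OF g c(1)]
        gen_cu_mor_sup[OF f c] gen_cu_mor_sup[OF g c]])
qed (simp_all add: gen_cu_morD[OF f] gen_cu_morD[OF g] T.add_mono T.plus_ac)

lemma plus_mor_prec:
  "\<lbrakk>mor_prec S T f f'; mor_prec S T g g'\<rbrakk>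
    \<Longrightarrow> mor_prec S T (\<lambda>a. f a \<oplus>\<^bsub>T\<^esub> g a) (\<lambda>a. f' a \<oplus>\<^bsub>T\<^esub> g' a)"
  by (simp add: mor_prec_def T.O3)

text \<open>Constant families are not paths in general; this one is because zero is way below
  itself.\<close>

lemma zero_cu_paths: "(\<lambda>_ _. \<zero>\<^bsub>T\<^esub>) \<in> cu_paths S T"
  by (intro cu_pathsI zero_gen_cu_mor mor_precI T.way_below_zero)

lemma plus_cu_paths:
  assumes f: "f \<in> cu_paths S T" and g: "g \<in> cu_paths S T"
  shows "(\<lambda>l a. f l a \<oplus>\<^bsub>T\<^esub> g l a) \<in> cu_paths S T"
proof (rule cu_pathsI)
  fix l assume "l \<in> I_Q"
  then show "(\<lambda>a. f l a \<oplus>\<^bsub>T\<^esub> g l a) \<in> gen_cu_mor S T"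
    by (intro plus_gen_cu_mor cu_paths_mor[OF f] cu_paths_mor[OF g])
next
  fix l' l assume "l' \<in> I_Q" "l \<in> I_Q" "l' < l"
  then show "mor_prec S T (\<lambda>a. f l' a \<oplus>\<^bsub>T\<^esub> g l' a) (\<lambda>a. f l a \<oplus>\<^bsub>T\<^esub> g l a)"
    by (intro plus_mor_prec cu_paths_prec[OF f] cu_paths_prec[OF g])
qed

lemma path_le_trans:
  assumes "path_le S T f g" "path_le S T g h"
  shows "path_le S T f h"
  using assms mor_prec_trans unfolding path_le_def by blast

lemma plus_path_le:
  assumes f: "path_le S T f f'" and g: "path_le S T g g'"
    and paths: "f' \<in> cu_paths S T" "g' \<in> cu_paths S T"
  shows "path_le S T (\<lambda>l a. f l a \<oplus>\<^bsub>T\<^esub> g l a) (\<lambda>l a. f' l a \<oplus>\<^bsub>T\<^esub> g' l a)"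
proof (rule path_leI)
  fix l assume l: "l \<in> I_Q"
  obtain m where m: "m \<in> I_Q" "mor_prec S T (f l) (f' m)" using path_leE[OF f l] .
  obtain m' where m': "m' \<in> I_Q" "mor_prec S T (g l) (g' m')" using path_leE[OF g l] .
  \<comment> \<open>The sum path uses one index for both summands, so the two indices found are
    raised to a common one.\<close>
  obtain n where n: "n \<in> I_Q" "m < n" "m' < n" using I_Q_above[OF m(1) m'(1)] .
  have "mor_prec S T (f l) (f' n)" "mor_prec S T (g l) (g' n)"
    using m m' n mor_prec_trans cu_paths_prec paths by metis+
  then show "\<exists>m\<in>I_Q. mor_prec S T (\<lambda>a. f l a \<oplus>\<^bsub>T\<^esub> g l a) (\<lambda>a. f' m a \<oplus>\<^bsub>T\<^esub> g' m a)"
    using n(1) plus_mor_prec by blast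
qed

section \<open>Order and addition on classes of paths\<close>

lemma path_rel_equiv: "equiv (cu_paths S T) (path_rel S T)"
proof (rule equivI)
  show "path_rel S T \<subseteq> cu_paths S T \<times> cu_paths S T"
    by (auto simp: path_rel_def)
  show "refl_on (cu_paths S T) (path_rel S T)"
    by (rule refl_onI) (simp add: path_rel_def path_le_refl)
  show "sym (path_rel S T)"
    by (rule symI) (simp add: path_rel_def)
  show "trans (path_rel S T)"
    by (rule transI) (use path_le_trans in \<open>simp add: path_rel_def, blast\<close>)
qed

lemma path_class_mem: "f \<in> cu_paths S T \<Longrightarrow> f \<in> path_class S T f"
  unfolding path_class_def by (rule equiv_class_self[OF path_rel_equiv])

lemma path_class_eq_iff:
  "\<lbrakk>f \<in> cu_paths S T; g \<in> cu_paths S T\<rbrakk>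
    \<Longrightarrow> path_class S T f = path_class S T g \<longleftrightarrow> path_le S T f g \<and> path_le S T g f"
  unfolding path_class_def by (subst eq_equiv_class_iff[OF path_rel_equiv]) (auto simp: path_rel_def)

lemma path_class_memD:
  "g \<in> path_class S T f \<Longrightarrow> g \<in> cu_paths S T \<and> path_le S T f g \<and> path_le S T g f"
  by (simp add: path_class_def path_rel_def)

text \<open>The order on classes only asks for some related representatives; transitivity of
  \<open>path_le\<close> moves the relation to the given ones.\<close>

lemma internal_hom_le_iff:
  assumes "f \<in> cu_paths S T" "g \<in> cu_paths S T"
  shows "path_class S T f \<sqsubseteq>\<^bsub>internal_hom S T\<^esub> path_class S T g \<longleftrightarrow> path_le S T f g"
proof
  assume "path_class S T f \<sqsubseteq>\<^bsub>internal_hom S T\<^esub> path_class S T g"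
  then obtain f' g' where "f' \<in> path_class S T f" "g' \<in> path_class S T g" "path_le S T f' g'"
    by (auto simp: internal_hom_def)
  then show "path_le S T f g"
    by (metis path_class_memD path_le_trans)
next
  assume "path_le S T f g"
  then show "path_class S T f \<sqsubseteq>\<^bsub>internal_hom S T\<^esub> path_class S T g"
    using assms path_class_mem by (auto simp: internal_hom_def)
qed

text \<open>Addition respects \<open>path_le\<close>, so all classes in the defining union coincide;
  as the index sets are nonempty, the union is that class.\<close>

lemma internal_hom_plus:
  assumes "f \<in> cu_paths S T" "g \<in> cu_paths S T"
  shows "path_class S T f \<oplus>\<^bsub>internal_hom S T\<^esub> path_class S T g
    = path_class S T (\<lambda>l a. f l a \<oplus>\<^bsub>T\<^esub> g l a)"
proof -
  have "path_class S T (\<lambda>l a. f' l a \<oplus>\<^bsub>T\<^esub> g' l a) = path_class S T (\<lambda>l a. f l a \<oplus>\<^bsub>T\<^esub> g l a)"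
    if "f' \<in> path_class S T f" "g' \<in> path_class S T g" for f' g'
    using that[THEN path_class_memD] assms
    by (simp add: path_class_eq_iff plus_cu_paths plus_path_le)
  moreover have "path_class S T f \<noteq> {}" "path_class S T g \<noteq> {}"
    using assms path_class_mem by blast+
  ultimately show ?thesis
    by (simp add: internal_hom_def cong: SUP_cong)
qed

lemma internal_hom_zero: "\<zero>\<^bsub>internal_hom S T\<^esub> = path_class S T (\<lambda>_ _. \<zero>\<^bsub>T\<^esub>)"
  by (simp add: internal_hom_def)

lemma internal_hom_plus_closed:
  "\<lbrakk>x \<in> carrier (internal_hom S T); y \<in> carrier (internal_hom S T)\<rbrakk>
    \<Longrightarrow> x \<oplus>\<^bsub>internal_hom S T\<^esub> y \<in> carrier (internal_hom S T)"
  by (auto simp: internal_hom_carrier internal_hom_plus plus_cu_paths)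

lemma internal_hom_zero_closed: "\<zero>\<^bsub>internal_hom S T\<^esub> \<in> carrier (internal_hom S T)"
  by (simp add: internal_hom_carrier internal_hom_zero zero_cu_paths)

lemma internal_hom_le_trans:
  "\<lbrakk>x \<sqsubseteq>\<^bsub>internal_hom S T\<^esub> y; y \<sqsubseteq>\<^bsub>internal_hom S T\<^esub> z; x \<in> carrier (internal_hom S T);
    y \<in> carrier (internal_hom S T); z \<in> carrier (internal_hom S T)\<rbrakk> \<Longrightarrow> x \<sqsubseteq>\<^bsub>internal_hom S T\<^esub> z"
  by (auto simp: internal_hom_carrier internal_hom_le_iff) (metis path_le_trans)

lemma internal_hom_le_antisym:
  "\<lbrakk>x \<sqsubseteq>\<^bsub>internal_hom S T\<^esub> y; y \<sqsubseteq>\<^bsub>internal_hom S T\<^esub> x; x \<in> carrier (internal_hom S T);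
    y \<in> carrier (internal_hom S T)\<rbrakk> \<Longrightarrow> x = y"
  by (elim internal_hom_carrierE)
    (simp add: internal_hom_le_iff path_class_eq_iff)

section \<open>Suprema of increasing sequences of classes\<close>

lemma internal_hom_incr_seqE:
  assumes "incr_seq (internal_hom S T) c"
  obtains F where "\<And>n. F n \<in> cu_paths S T" "\<And>n. c n = path_class S T (F n)"
    "\<And>n. path_le S T (F n) (F (Suc n))"
proof -
  have "\<forall>n. \<exists>f. f \<in> cu_paths S T \<and> c n = path_class S T f"
    using incr_seq_carrier[OF assms] by (auto simp: internal_hom_carrier)
  then obtain F where F: "\<And>n. F n \<in> cu_paths S T" "\<And>n. c n = path_class S T (F n)"
    by metis
  then have "path_le S T (F n) (F (Suc n))" for n
    using incr_seq_Suc[OF assms, of n] by (simp add: internal_hom_le_iff)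
  then show thesis using that F by metis
qed

text \<open>Gluing, applied to the relation \<open>mor_prec\<close>. That each \<open>h l\<close> is
  literally some \<open>F n m\<close> makes the values of \<open>h\<close> morphisms, gives
  leastness of the bound, and later passes properties of the \<open>F n\<close> on to the
  supremum.\<close>

lemma internal_hom_sup:
  assumes F: "\<And>n. F n \<in> cu_paths S T" "\<And>n. path_le S T (F n) (F (Suc n))"
  obtains h where "h \<in> cu_paths S T" "\<And>l. l \<in> I_Q \<Longrightarrow> \<exists>n. \<exists>m\<in>I_Q. h l = F n m"
    "is_seq_sup (internal_hom S T) (\<lambda>n. path_class S T (F n)) (path_class S T h)"
proof -
  have F_prec: "mor_prec S T (F n l) (F n l')" if "l \<in> I_Q" "l' \<in> I_Q" "l < l'" for n l l'
    using cu_paths_prec[OF F(1) that] .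
  have F_le: "\<exists>m\<in>I_Q. mor_prec S T (F n l) (F (Suc n) m)" if "l \<in> I_Q" for n l
    using path_leE[OF F(2) that] by metis
  have "\<exists>h. (\<forall>l\<in>I_Q. \<exists>n. \<exists>m\<in>I_Q. h l = F n m) \<and>
    (\<forall>l\<in>I_Q. \<forall>l'\<in>I_Q. l < l' \<longrightarrow> mor_prec S T (h l) (h l')) \<and>
    (\<forall>n. \<forall>l\<in>I_Q. \<exists>m\<in>I_Q. mor_prec S T (F n l) (h m))"
    by (rule glue_increasing_families) (erule mor_prec_trans F_prec F_le; assumption)+
  then obtain h where h: "\<forall>l\<in>I_Q. \<exists>n. \<exists>m\<in>I_Q. h l = F n m"
    "\<forall>l\<in>I_Q. \<forall>l'\<in>I_Q. l < l' \<longrightarrow> mor_prec S T (h l) (h l')"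
    "\<forall>n. \<forall>l\<in>I_Q. \<exists>m\<in>I_Q. mor_prec S T (F n l) (h m)"
    by (elim exE conjE)
  have hp: "h \<in> cu_paths S T"
  proof (rule cu_pathsI)
    fix l assume "l \<in> I_Q"
    then obtain n m where "m \<in> I_Q" "h l = F n m" using h(1) by blast
    then show "h l \<in> gen_cu_mor S T" using cu_paths_mor[OF F(1)] by simp
  qed (use h(2) in blast)
  have "is_seq_sup (internal_hom S T) (\<lambda>n. path_class S T (F n)) (path_class S T h)"
  proof (rule is_seq_supI)
    show "incr_seq (internal_hom S T) (\<lambda>n. path_class S T (F n))"
      using F by (simp add: incr_seq_def internal_hom_carrier internal_hom_le_iff)
    show "path_class S T h \<in> carrier (internal_hom S T)"
      using hp by (simp add: internal_hom_carrier)
    show "path_class S T (F n) \<sqsubseteq>\<^bsub>internal_hom S T\<^esub> path_class S T h" for n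
      using h(3) F(1) hp by (simp add: internal_hom_le_iff path_le_def)
  next
    fix x assume "x \<in> carrier (internal_hom S T)"
      and ub: "\<And>n. path_class S T (F n) \<sqsubseteq>\<^bsub>internal_hom S T\<^esub> x"
    then obtain g where g: "g \<in> cu_paths S T" "x = path_class S T g"
      by (auto simp: internal_hom_carrier)
    then have Fg: "path_le S T (F n) g" for n
      using ub F(1) by (simp add: internal_hom_le_iff)
    have "path_le S T h g"
    proof (rule path_leI)
      fix l assume "l \<in> I_Q"
      then obtain n m where "m \<in> I_Q" "h l = F n m" using h(1) by blast
      then show "\<exists>m\<in>I_Q. mor_prec S T (h l) (g m)" using path_leE[OF Fg] by metis
    qed
    then show "path_class S T h \<sqsubseteq>\<^bsub>internal_hom S T\<^esub> x"
      using g hp by (simp add: internal_hom_le_iff)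
  qed
  with hp h(1) show thesis by (intro that) blast+
qed

section \<open>Truncated paths and way-below\<close>

lemma cut_cu_paths:
  assumes "f \<in> cu_paths S T" "m \<in> I_Q"
  shows "(\<lambda>l. f (m * l)) \<in> cu_paths S T"
  using assms by (intro cu_pathsI cu_paths_mor[OF assms(1)] cu_paths_prec[OF assms(1)] I_Q_mult) auto

text \<open>The single morphism \<open>f m\<close> dominates the whole truncation. If
  \<open>[f]\<close> is below a supremum represented by a glued path \<open>h\<close>, then
  \<open>f m\<close> is below one \<open>h k\<close>, which already occurs in one of the paths
  \<open>F n\<close>.\<close>

lemma cut_path_way_below:
  assumes f: "f \<in> cu_paths S T" and m: "m \<in> I_Q"
  shows "way_below (internal_hom S T) (path_class S T (\<lambda>l. f (m * l))) (path_class S T f)"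
proof (rule way_belowI)
  show "path_class S T (\<lambda>l. f (m * l)) \<in> carrier (internal_hom S T)"
    "path_class S T f \<in> carrier (internal_hom S T)"
    using f m cut_cu_paths by (auto simp: internal_hom_carrier)
next
  fix c s assume c: "incr_seq (internal_hom S T) c" "is_seq_sup (internal_hom S T) c s"
    and le: "path_class S T f \<sqsubseteq>\<^bsub>internal_hom S T\<^esub> s"
  obtain F where F: "\<And>n. F n \<in> cu_paths S T" "\<And>n. c n = path_class S T (F n)"
    "\<And>n. path_le S T (F n) (F (Suc n))" using internal_hom_incr_seqE[OF c(1)] by blast
  obtain h where h: "h \<in> cu_paths S T" "\<And>l. l \<in> I_Q \<Longrightarrow> \<exists>n. \<exists>m\<in>I_Q. h l = F n m"
    "is_seq_sup (internal_hom S T) (\<lambda>n. path_class S T (F n)) (path_class S T h)"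
    using internal_hom_sup[of F, OF F(1,3)] by blast
  \<comment> \<open>Both are suprema of the same sequence, since \<open>c n\<close> is the class of
    \<open>F n\<close>.\<close>
  have "s \<sqsubseteq>\<^bsub>internal_hom S T\<^esub> path_class S T h"
    using seq_sup_least[OF c] seq_sup_carrier[of "internal_hom S T" c]
      seq_sup_upper[of "internal_hom S T" c] c h(3) F(2) by (metis (no_types, lifting) ext)
  then have "path_le S T f h"
    using le f h(1) internal_hom_le_trans seq_sup_carrier[OF c]
    by (metis internal_hom_le_iff internal_hom_carrier imageI)
  then obtain k where k: "k \<in> I_Q" "mor_prec S T (f m) (h k)"
    using m by (rule path_leE)
  obtain n q where nq: "q \<in> I_Q" "h k = F n q" using h(2)[OF k(1)] by blast
  have "path_le S T (\<lambda>l. f (m * l)) (F n)"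
  proof (rule path_leI)
    fix l assume l: "l \<in> I_Q"
    have "mor_prec S T (f (m * l)) (f m)"
      using l m I_Q_mult by (intro cu_paths_prec[OF f]) auto
    then show "\<exists>q\<in>I_Q. mor_prec S T (f (m * l)) (F n q)"
      using k nq mor_prec_trans by metis
  qed
  then show "\<exists>k. path_class S T (\<lambda>l. f (m * l)) \<sqsubseteq>\<^bsub>internal_hom S T\<^esub> c k"
    using F cut_cu_paths[OF f m] internal_hom_le_iff by metis
qed

text \<open>The class of \<open>f\<close> is the supremum of its truncations at the levels
  \<open>cut_point n\<close>, so anything way below it is below one of them.\<close>

lemma way_below_cut_path:
  assumes x: "way_below (internal_hom S T) x (path_class S T f)" and f: "f \<in> cu_paths S T"
  obtains m where "m \<in> I_Q" "x \<sqsubseteq>\<^bsub>internal_hom S T\<^esub> path_class S T (\<lambda>l. f (m * l))"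
proof -
  define F where "F n = (\<lambda>l. f (cut_point n * l))" for n
  have Fp: "F n \<in> cu_paths S T" for n
    unfolding F_def by (rule cut_cu_paths[OF f cut_point_I_Q])
  have incr: "incr_seq (internal_hom S T) (\<lambda>n. path_class S T (F n))"
  proof -
    have "mor_prec S T (F n l) (F (Suc n) l)" if "l \<in> I_Q" for n l
      unfolding F_def using that cut_point_strict_mono[of n "Suc n"]
      by (intro cu_paths_prec[OF f] I_Q_mult cut_point_I_Q mult_strict_right_mono) auto
    then have "path_le S T (F n) (F (Suc n))" for n
      by (blast intro: path_leI)
    then show ?thesis
      using Fp by (simp add: incr_seq_def internal_hom_carrier internal_hom_le_iff)
  qed
  have "is_seq_sup (internal_hom S T) (\<lambda>n. path_class S T (F n)) (path_class S T f)"
  proof (rule is_seq_supI[OF incr])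
    show "path_class S T f \<in> carrier (internal_hom S T)"
      using f by (simp add: internal_hom_carrier)
    have "mor_prec S T (F n l) (f l)" if "l \<in> I_Q" for n l
      unfolding F_def using that cut_point_I_Q[of n] mult_strict_right_mono[of "cut_point n" 1 l]
      by (intro cu_paths_prec[OF f] I_Q_mult cut_point_I_Q) auto
    then have "path_le S T (F n) f" for n
      by (blast intro: path_leI)
    then show "path_class S T (F n) \<sqsubseteq>\<^bsub>internal_hom S T\<^esub> path_class S T f" for n
      using Fp f by (simp add: internal_hom_le_iff)
  next
    fix y assume "y \<in> carrier (internal_hom S T)"
      and ub: "\<And>n. path_class S T (F n) \<sqsubseteq>\<^bsub>internal_hom S T\<^esub> y"
    then obtain g where g: "g \<in> cu_paths S T" "y = path_class S T g"
      by (auto simp: internal_hom_carrier)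
    then have Fg: "path_le S T (F n) g" for n
      using ub Fp by (simp add: internal_hom_le_iff)
    have "path_le S T f g"
    proof (rule path_leI)
      fix l assume l: "l \<in> I_Q"
      \<comment> \<open>Every \<open>f l\<close> occurs in a late enough truncation, at the rescaled
        index \<open>l / cut_point n\<close>.\<close>
      obtain n where n: "l < cut_point n" using cut_point_exceeds[OF l] by metis
      then have "l / cut_point n \<in> I_Q" "F n (l / cut_point n) = f l"
        using l cut_point_I_Q[of n] by (auto simp: F_def)
      then show "\<exists>m\<in>I_Q. mor_prec S T (f l) (g m)" using path_leE[OF Fg] by metis
    qed
    then show "path_class S T f \<sqsubseteq>\<^bsub>internal_hom S T\<^esub> y"
      using g f by (simp add: internal_hom_le_iff)
  qed
  moreover have "path_class S T f \<sqsubseteq>\<^bsub>internal_hom S T\<^esub> path_class S T f"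
    using f by (simp add: internal_hom_le_iff path_le_refl)
  ultimately obtain k where "x \<sqsubseteq>\<^bsub>internal_hom S T\<^esub> path_class S T (F k)"
    using way_belowD[OF x incr] by blast
  then show thesis using that cut_point_I_Q unfolding F_def by blast
qed

end

section \<open>Quotients by ideals\<close>

locale cu_ideal_pair = cu_pair S T
  for S :: "('a, 'm) ordered_semigroup_scheme" and T :: "('b, 'n) ordered_semigroup_scheme" +
  fixes J :: "'a set"
  assumes ideal: "cu_ideal S J"
begin

abbreviation Q :: "'a set ordered_semigroup" where "Q \<equiv> cu_quot S J"
abbreviation \<pi> :: "'a \<Rightarrow> 'a set" where "\<pi> \<equiv> quot_map S J"

section \<open>Ideals and the induced preorder\<close>

lemma ideal_carrier: "a \<in> J \<Longrightarrow> a \<in> carrier S"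
  using ideal submonoid.subset[of J "additive S"] by (auto simp: cu_ideal_def additive_def)

lemma ideal_zero: "\<zero>\<^bsub>S\<^esub> \<in> J"
  using ideal submonoid.one_closed[of J "additive S"] by (simp add: cu_ideal_def additive_def)

lemma ideal_plus: "\<lbrakk>a \<in> J; b \<in> J\<rbrakk> \<Longrightarrow> a \<oplus>\<^bsub>S\<^esub> b \<in> J"
  using ideal submonoid.m_closed[of J "additive S" a b] by (simp add: cu_ideal_def additive_def)

lemma ideal_sup: "\<lbrakk>incr_seq S c; \<And>n. c n \<in> J; is_seq_sup S c s\<rbrakk> \<Longrightarrow> s \<in> J"
  using ideal unfolding cu_ideal_def by blast

text \<open>Each term of \<open>r\<close> doubles the previous one and adds the next
  \<open>d\<close>. Doubling a term therefore stays below the next term, so by O4 the supremum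
  \<open>e\<close> is idempotent; it lies in \<open>J\<close> by closure under suprema.\<close>

lemma ideal_absorbing:
  fixes d :: "nat \<Rightarrow> 'a"
  assumes d: "\<And>n. d n \<in> J"
  shows "\<exists>e\<in>J. e \<oplus>\<^bsub>S\<^esub> e = e \<and> (\<forall>n. d n \<sqsubseteq>\<^bsub>S\<^esub> e)"
proof -
  define r where "r = rec_nat (d 0) (\<lambda>n x. x \<oplus>\<^bsub>S\<^esub> x \<oplus>\<^bsub>S\<^esub> d (Suc n))"
  have r_Suc: "r (Suc n) = r n \<oplus>\<^bsub>S\<^esub> r n \<oplus>\<^bsub>S\<^esub> d (Suc n)" and r_0: "r 0 = d 0" for n
    by (simp_all add: r_def)
  have rJ: "r n \<in> J" for n
    by (induction n) (simp_all add: r_0 r_Suc d ideal_plus)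
  note rS = ideal_carrier[OF rJ]
  have double: "r n \<oplus>\<^bsub>S\<^esub> r n \<sqsubseteq>\<^bsub>S\<^esub> r (Suc n)" for n
    by (simp add: r_Suc S.le_plus_right rS ideal_carrier[OF d])
  have incr: "incr_seq S r"
    unfolding incr_seq_def
    using S.le_trans[OF S.le_plus_right double] by (simp add: rS)
  obtain e where e: "is_seq_sup S r e" using S.O1[OF incr] by blast
  have eS: "e \<in> carrier S" using seq_sup_carrier[OF incr e] .
  have eJ: "e \<in> J" using ideal_sup[OF incr rJ e] .
  have "e \<oplus>\<^bsub>S\<^esub> e \<sqsubseteq>\<^bsub>S\<^esub> e"
  proof (rule seq_sup_least[OF S.incr_seq_plus[OF incr incr] S.O4[OF incr incr e e] eS])
    show "r n \<oplus>\<^bsub>S\<^esub> r n \<sqsubseteq>\<^bsub>S\<^esub> e" for n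
      using S.le_trans[OF double seq_sup_upper[OF incr e]] by (simp add: rS eS)
  qed
  then have "e \<oplus>\<^bsub>S\<^esub> e = e"
    by (intro S.le_antisym) (simp_all add: eS S.le_plus_right)
  moreover have "d n \<sqsubseteq>\<^bsub>S\<^esub> r n" for n
    by (cases n) (simp_all add: r_0 r_Suc S.le_plus_left rS ideal_carrier[OF d])
  then have "d n \<sqsubseteq>\<^bsub>S\<^esub> e" for n
    by (rule S.le_trans[OF _ seq_sup_upper[OF incr e]]) (simp_all add: rS eS ideal_carrier[OF d])
  ultimately show ?thesis using eJ by blast
qed

lemma ideal_leI: "\<lbrakk>c \<in> J; a \<sqsubseteq>\<^bsub>S\<^esub> b \<oplus>\<^bsub>S\<^esub> c\<rbrakk> \<Longrightarrow> ideal_le S J a b"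
  unfolding ideal_le_def by blast

lemma le_imp_ideal_le: "\<lbrakk>a \<in> carrier S; b \<in> carrier S; a \<sqsubseteq>\<^bsub>S\<^esub> b\<rbrakk> \<Longrightarrow> ideal_le S J a b"
  by (rule ideal_leI[OF ideal_zero]) simp

lemma ideal_le_refl: "a \<in> carrier S \<Longrightarrow> ideal_le S J a a"
  by (simp add: le_imp_ideal_le)

lemma ideal_le_trans:
  assumes ab: "ideal_le S J a b" and bc: "ideal_le S J b c"
    and S: "a \<in> carrier S" "b \<in> carrier S" "c \<in> carrier S"
  shows "ideal_le S J a c"
proof -
  obtain x where x: "x \<in> J" "a \<sqsubseteq>\<^bsub>S\<^esub> b \<oplus>\<^bsub>S\<^esub> x" using ab by (auto simp: ideal_le_def)
  obtain y where y: "y \<in> J" "b \<sqsubseteq>\<^bsub>S\<^esub> c \<oplus>\<^bsub>S\<^esub> y" using bc by (auto simp: ideal_le_def)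
  note [simp] = ideal_carrier[OF x(1)] ideal_carrier[OF y(1)] S
  have "b \<oplus>\<^bsub>S\<^esub> x \<sqsubseteq>\<^bsub>S\<^esub> c \<oplus>\<^bsub>S\<^esub> y \<oplus>\<^bsub>S\<^esub> x"
    by (simp add: S.add_mono y(2))
  then have "a \<sqsubseteq>\<^bsub>S\<^esub> c \<oplus>\<^bsub>S\<^esub> (y \<oplus>\<^bsub>S\<^esub> x)"
    using S.le_trans[OF x(2)] by (simp add: S.plus_assoc)
  then show ?thesis using ideal_leI[OF ideal_plus[OF y(1) x(1)]] by simp
qed

lemma ideal_le_plus:
  assumes le: "ideal_le S J a b" "ideal_le S J a' b'"
    and S: "a \<in> carrier S" "b \<in> carrier S" "a' \<in> carrier S" "b' \<in> carrier S"
  shows "ideal_le S J (a \<oplus>\<^bsub>S\<^esub> a') (b \<oplus>\<^bsub>S\<^esub> b')"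
proof -
  obtain x where x: "x \<in> J" "a \<sqsubseteq>\<^bsub>S\<^esub> b \<oplus>\<^bsub>S\<^esub> x" using le(1) by (auto simp: ideal_le_def)
  obtain y where y: "y \<in> J" "a' \<sqsubseteq>\<^bsub>S\<^esub> b' \<oplus>\<^bsub>S\<^esub> y" using le(2) by (auto simp: ideal_le_def)
  note [simp] = ideal_carrier[OF x(1)] ideal_carrier[OF y(1)] S
  have "a \<oplus>\<^bsub>S\<^esub> a' \<sqsubseteq>\<^bsub>S\<^esub> (b \<oplus>\<^bsub>S\<^esub> x) \<oplus>\<^bsub>S\<^esub> (b' \<oplus>\<^bsub>S\<^esub> y)"
    by (simp add: S.add_mono x(2) y(2))
  also have "(b \<oplus>\<^bsub>S\<^esub> x) \<oplus>\<^bsub>S\<^esub> (b' \<oplus>\<^bsub>S\<^esub> y) = (b \<oplus>\<^bsub>S\<^esub> b') \<oplus>\<^bsub>S\<^esub> (x \<oplus>\<^bsub>S\<^esub> y)"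
    by (simp add: S.plus_ac)
  finally show ?thesis by (rule ideal_leI[OF ideal_plus[OF x(1) y(1)]])
qed

lemma ideal_rel_equiv: "equiv (carrier S) (ideal_rel S J)"
proof (rule equivI)
  show "ideal_rel S J \<subseteq> carrier S \<times> carrier S"
    by (auto simp: ideal_rel_def)
  show "refl_on (carrier S) (ideal_rel S J)"
    by (rule refl_onI) (simp add: ideal_rel_def ideal_le_refl)
  show "sym (ideal_rel S J)"
    by (rule symI) (simp add: ideal_rel_def)
  show "trans (ideal_rel S J)"
    by (rule transI) (simp add: ideal_rel_def, metis ideal_le_trans)
qed

lemma quot_map_self: "a \<in> carrier S \<Longrightarrow> a \<in> \<pi> a"
  unfolding quot_map_def by (rule equiv_class_self[OF ideal_rel_equiv])

lemma quot_map_memD: "b \<in> \<pi> a \<Longrightarrow> b \<in> carrier S \<and> ideal_le S J a b \<and> ideal_le S J b a"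
  by (simp add: quot_map_def ideal_rel_def)

lemma quot_map_eq_iff:
  "\<lbrakk>a \<in> carrier S; b \<in> carrier S\<rbrakk> \<Longrightarrow> \<pi> a = \<pi> b \<longleftrightarrow> ideal_le S J a b \<and> ideal_le S J b a"
  unfolding quot_map_def by (subst eq_equiv_class_iff[OF ideal_rel_equiv]) (auto simp: ideal_rel_def)

section \<open>The quotient as a positively ordered semigroup\<close>

lemma quot_carrier: "carrier Q = \<pi> ` carrier S"
  by (auto simp: cu_quot_def quotient_def quot_map_def)

lemma quot_map_closed [simp]: "a \<in> carrier S \<Longrightarrow> \<pi> a \<in> carrier Q"
  by (simp add: quot_carrier)

lemma quot_carrierE:
  assumes "A \<in> carrier Q"
  obtains a where "a \<in> carrier S" "A = \<pi> a"
  using assms unfolding quot_carrier by blast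

lemma quot_le_iff:
  assumes "a \<in> carrier S" "b \<in> carrier S"
  shows "\<pi> a \<sqsubseteq>\<^bsub>Q\<^esub> \<pi> b \<longleftrightarrow> ideal_le S J a b"
proof
  assume "\<pi> a \<sqsubseteq>\<^bsub>Q\<^esub> \<pi> b"
  then obtain a' b' where "a' \<in> \<pi> a" "b' \<in> \<pi> b" "ideal_le S J a' b'"
    by (auto simp: cu_quot_def)
  then show "ideal_le S J a b"
    using assms by (metis quot_map_memD ideal_le_trans)
next
  assume "ideal_le S J a b"
  then show "\<pi> a \<sqsubseteq>\<^bsub>Q\<^esub> \<pi> b"
    using assms quot_map_self by (auto simp: cu_quot_def)
qed

lemma quot_plus:
  assumes "a \<in> carrier S" "b \<in> carrier S"
  shows "\<pi> a \<oplus>\<^bsub>Q\<^esub> \<pi> b = \<pi> (a \<oplus>\<^bsub>S\<^esub> b)"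
proof -
  have "\<pi> (a' \<oplus>\<^bsub>S\<^esub> b') = \<pi> (a \<oplus>\<^bsub>S\<^esub> b)" if "a' \<in> \<pi> a" "b' \<in> \<pi> b" for a' b'
    using that[THEN quot_map_memD] assms by (simp add: quot_map_eq_iff ideal_le_plus)
  moreover have "\<pi> a \<noteq> {}" "\<pi> b \<noteq> {}"
    using assms quot_map_self by blast+
  ultimately show ?thesis
    by (simp add: cu_quot_def cong: SUP_cong)
qed

lemma quot_zero: "\<zero>\<^bsub>Q\<^esub> = \<pi> \<zero>\<^bsub>S\<^esub>"
  by (simp add: cu_quot_def)

lemma quot_pos_ordered_semigroup: "pos_ordered_semigroup Q"
proof -
  have eq: "(.=\<^bsub>Q\<^esub>) = (=)" by (simp add: cu_quot_def)
  have "partial_order Q"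
  proof
    fix A B C assume "A \<sqsubseteq>\<^bsub>Q\<^esub> B" "B \<sqsubseteq>\<^bsub>Q\<^esub> C" "A \<in> carrier Q" "B \<in> carrier Q" "C \<in> carrier Q"
    then show "A \<sqsubseteq>\<^bsub>Q\<^esub> C"
      by (elim quot_carrierE) (simp add: quot_le_iff, metis ideal_le_trans)
  next
    fix A B assume "A \<sqsubseteq>\<^bsub>Q\<^esub> B" "B \<sqsubseteq>\<^bsub>Q\<^esub> A" "A \<in> carrier Q" "B \<in> carrier Q"
    then show "A .=\<^bsub>Q\<^esub> B"
      by (elim quot_carrierE) (simp add: eq quot_le_iff quot_map_eq_iff)
  qed (auto simp: eq quot_le_iff ideal_le_refl elim!: quot_carrierE)
  moreover have "comm_monoid (additive Q)"
    by (rule comm_monoidI)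
      (auto simp: additive_def quot_zero quot_plus S.plus_ac elim!: quot_carrierE)
  moreover have "A \<oplus>\<^bsub>Q\<^esub> C \<sqsubseteq>\<^bsub>Q\<^esub> B \<oplus>\<^bsub>Q\<^esub> C"
    if "A \<in> carrier Q" "B \<in> carrier Q" "C \<in> carrier Q" "A \<sqsubseteq>\<^bsub>Q\<^esub> B" for A B C
    using that by (elim quot_carrierE) (simp add: quot_plus quot_le_iff ideal_le_plus ideal_le_refl)
  moreover have "\<zero>\<^bsub>Q\<^esub> \<sqsubseteq>\<^bsub>Q\<^esub> A" if "A \<in> carrier Q" for A
    using that by (elim quot_carrierE) (simp add: quot_zero quot_le_iff le_imp_ideal_le S.zero_least)
  ultimately show ?thesis
    by (simp add: pos_ordered_semigroup_def pos_ordered_semigroup_axioms_def)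
qed

section \<open>The quotient map and the axioms O1 to O4\<close>

lemma quot_map_mono:
  "\<lbrakk>a \<in> carrier S; b \<in> carrier S; a \<sqsubseteq>\<^bsub>S\<^esub> b\<rbrakk> \<Longrightarrow> \<pi> a \<sqsubseteq>\<^bsub>Q\<^esub> \<pi> b"
  by (simp add: quot_le_iff le_imp_ideal_le)

lemma quot_map_incr_seq: "incr_seq S c \<Longrightarrow> incr_seq Q (\<lambda>n. \<pi> (c n))"
  by (simp add: incr_seq_def quot_map_mono)

text \<open>An upper bound in the quotient is one in \<open>S\<close> up to an error depending on
  \<open>n\<close>. A single \<open>e\<close> in \<open>J\<close> dominates all these errors, so the
  supremum in \<open>S\<close> is below \<open>u\<close> plus \<open>e\<close>.\<close>

lemma quot_map_sup:
  assumes c: "incr_seq S c" "is_seq_sup S c s"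
  shows "is_seq_sup Q (\<lambda>n. \<pi> (c n)) (\<pi> s)"
proof (rule is_seq_supI[OF quot_map_incr_seq[OF c(1)]])
  note [simp] = incr_seq_carrier[OF c(1)] seq_sup_carrier[OF c]
  show "\<pi> s \<in> carrier Q" by simp
  show "\<pi> (c n) \<sqsubseteq>\<^bsub>Q\<^esub> \<pi> s" for n
    by (simp add: quot_map_mono seq_sup_upper[OF c])
  fix U assume "U \<in> carrier Q" and ub: "\<And>n. \<pi> (c n) \<sqsubseteq>\<^bsub>Q\<^esub> U"
  then obtain u where u [simp]: "u \<in> carrier S" and U: "U = \<pi> u"
    by (blast elim: quot_carrierE)
  have "\<forall>n. \<exists>d\<in>J. c n \<sqsubseteq>\<^bsub>S\<^esub> u \<oplus>\<^bsub>S\<^esub> d"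
    using ub unfolding U by (simp add: quot_le_iff ideal_le_def)
  then obtain d where d: "\<And>n. d n \<in> J" "\<And>n. c n \<sqsubseteq>\<^bsub>S\<^esub> u \<oplus>\<^bsub>S\<^esub> d n" by metis
  obtain e where e: "e \<in> J" "\<forall>n. d n \<sqsubseteq>\<^bsub>S\<^esub> e"
    using ideal_absorbing[of d, OF d(1)] by blast
  note [simp] = ideal_carrier[OF d(1)] ideal_carrier[OF e(1)]
  have "c n \<sqsubseteq>\<^bsub>S\<^esub> u \<oplus>\<^bsub>S\<^esub> e" for n
    by (rule S.le_trans[OF d(2)]) (simp_all add: S.add_mono e(2))
  then have "s \<sqsubseteq>\<^bsub>S\<^esub> u \<oplus>\<^bsub>S\<^esub> e"
    by (intro seq_sup_least[OF c]) simp_all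
  then show "\<pi> s \<sqsubseteq>\<^bsub>Q\<^esub> U"
    unfolding U using e(1) by (simp add: quot_le_iff ideal_leI)
qed

text \<open>Adding an idempotent of \<open>J\<close> that dominates all the error terms turns an increasing
  sequence of classes into an increasing sequence of representatives.\<close>

lemma quot_incr_seq_lift:
  assumes C: "incr_seq Q C"
  obtains c where "incr_seq S c" "C = (\<lambda>n. \<pi> (c n))"
proof -
  have "\<forall>n. \<exists>a. a \<in> carrier S \<and> C n = \<pi> a"
    using incr_seq_carrier[OF C] unfolding quot_carrier by blast
  then obtain a where a [simp]: "\<And>n. a n \<in> carrier S" and Ca: "\<And>n. C n = \<pi> (a n)" by metis
  have "\<forall>n. \<exists>d\<in>J. a n \<sqsubseteq>\<^bsub>S\<^esub> a (Suc n) \<oplus>\<^bsub>S\<^esub> d"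
    using incr_seq_Suc[OF C] unfolding Ca by (simp add: quot_le_iff ideal_le_def)
  then obtain d where d: "\<And>n. d n \<in> J" "\<And>n. a n \<sqsubseteq>\<^bsub>S\<^esub> a (Suc n) \<oplus>\<^bsub>S\<^esub> d n" by metis
  obtain e where e: "e \<in> J" "e \<oplus>\<^bsub>S\<^esub> e = e" "\<forall>n. d n \<sqsubseteq>\<^bsub>S\<^esub> e"
    using ideal_absorbing[of d, OF d(1)] by blast
  note [simp] = ideal_carrier[OF d(1)] ideal_carrier[OF e(1)]
  have "a n \<oplus>\<^bsub>S\<^esub> e \<sqsubseteq>\<^bsub>S\<^esub> a (Suc n) \<oplus>\<^bsub>S\<^esub> e" for n
  proof -
    have "a n \<sqsubseteq>\<^bsub>S\<^esub> a (Suc n) \<oplus>\<^bsub>S\<^esub> e"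
      by (rule S.le_trans[OF d(2)]) (simp_all add: S.add_mono e(3))
    \<comment> \<open>Adding \<open>e\<close> on both sides leaves two copies on the right, which
      idempotence merges.\<close>
    then have "a n \<oplus>\<^bsub>S\<^esub> e \<sqsubseteq>\<^bsub>S\<^esub> a (Suc n) \<oplus>\<^bsub>S\<^esub> e \<oplus>\<^bsub>S\<^esub> e"
      by (simp add: S.add_mono)
    then show ?thesis by (simp add: S.plus_assoc e(2))
  qed
  then have "incr_seq S (\<lambda>n. a n \<oplus>\<^bsub>S\<^esub> e)" by (simp add: incr_seq_def)
  moreover have "C = (\<lambda>n. \<pi> (a n \<oplus>\<^bsub>S\<^esub> e))"
  proof
    show "C n = \<pi> (a n \<oplus>\<^bsub>S\<^esub> e)" for n
      unfolding Ca using ideal_leI[OF e(1), of "a n \<oplus>\<^bsub>S\<^esub> e" "a n"]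
      by (simp add: quot_map_eq_iff le_imp_ideal_le S.le_plus_right)
  qed
  ultimately show thesis by (rule that)
qed

text \<open>The lifted sequence has a supremum by O1, \<open>\<pi>\<close> preserves it, and suprema
  in the quotient are unique.\<close>

lemma quot_sup_lift:
  assumes C: "incr_seq Q C" "is_seq_sup Q C A"
  obtains c s where "incr_seq S c" "is_seq_sup S c s" "C = (\<lambda>n. \<pi> (c n))" "A = \<pi> s"
proof -
  obtain c where c: "incr_seq S c" "C = (\<lambda>n. \<pi> (c n))"
    using quot_incr_seq_lift[OF C(1)] .
  obtain s where s: "is_seq_sup S c s" using S.O1[OF c(1)] by blast
  have "A = \<pi> s"
    using pos_ordered_semigroup.seq_sup_unique[OF quot_pos_ordered_semigroup C]
      quot_map_sup[OF c(1) s] unfolding c(2) by blast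
  then show thesis using that c s by blast
qed

text \<open>After lifting the sequence, the error \<open>d\<close> is added to it as a constant
  sequence: O4 makes \<open>s\<close> plus \<open>d\<close> a supremum that dominates
  \<open>b\<close>, and \<open>d\<close> disappears again in the quotient.\<close>

lemma quot_map_way_below:
  assumes ab: "way_below S a b"
  shows "way_below Q (\<pi> a) (\<pi> b)"
proof (rule way_belowI)
  note [simp] = way_below_carrier_left[OF ab] way_below_carrier_right[OF ab]
  show "\<pi> a \<in> carrier Q" "\<pi> b \<in> carrier Q" by simp_all
  fix C A assume "incr_seq Q C" "is_seq_sup Q C A" and le: "\<pi> b \<sqsubseteq>\<^bsub>Q\<^esub> A"
  then obtain c s where c: "incr_seq S c" "is_seq_sup S c s" and CA: "C = (\<lambda>n. \<pi> (c n))" "A = \<pi> s"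
    using quot_sup_lift by blast
  note [simp] = incr_seq_carrier[OF c(1)] seq_sup_carrier[OF c]
  obtain d where d: "d \<in> J" "b \<sqsubseteq>\<^bsub>S\<^esub> s \<oplus>\<^bsub>S\<^esub> d"
    using le by (auto simp: CA quot_le_iff ideal_le_def)
  note dS = ideal_carrier[OF d(1)]
  obtain k where "a \<sqsubseteq>\<^bsub>S\<^esub> c k \<oplus>\<^bsub>S\<^esub> d"
    using way_belowD[OF ab S.incr_seq_plus[OF c(1) S.incr_seq_const[OF dS]]
        S.O4[OF c(1) S.incr_seq_const[OF dS] c(2) S.seq_sup_const[OF dS]] d(2)] by blast
  then have "\<pi> a \<sqsubseteq>\<^bsub>Q\<^esub> C k"
    using d(1) by (simp add: CA quot_le_iff ideal_leI)
  then show "\<exists>k. \<pi> a \<sqsubseteq>\<^bsub>Q\<^esub> C k" by blast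
qed

text \<open>Approximate \<open>b\<close> in \<open>S\<close> by elements way below it;
  \<open>\<pi>\<close> preserves this supremum, so \<open>A\<close> is below the image of one of
  them.\<close>

lemma quot_way_below_lift:
  assumes A: "way_below Q A (\<pi> b)" and b: "b \<in> carrier S"
  obtains a where "way_below S a b" "A \<sqsubseteq>\<^bsub>Q\<^esub> \<pi> a"
proof -
  obtain c where c: "incr_seq S c" "is_seq_sup S c b" "\<And>n. way_below S (c n) b"
    using S.way_below_approx[OF b] by metis
  have "\<pi> b \<sqsubseteq>\<^bsub>Q\<^esub> \<pi> b" using b by (simp add: quot_map_mono)
  then obtain k where "A \<sqsubseteq>\<^bsub>Q\<^esub> \<pi> (c k)"
    using way_belowD[OF A quot_map_incr_seq[OF c(1)] quot_map_sup[OF c(1,2)]] by blast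
  then show thesis using that c(3) by blast
qed

text \<open>O1, O2 and O4 are transported along \<open>\<pi>\<close> from sequences in
  \<open>S\<close>. For O3, the left members of the pairs are enlarged to images of elements way
  below in \<open>S\<close>.\<close>

lemma quot_cu_semigroup: "cu_semigroup Q"
proof -
  interpret Q: pos_ordered_semigroup Q by (rule quot_pos_ordered_semigroup)
  show ?thesis
  proof
    fix C assume "incr_seq Q C"
    then obtain c where c: "incr_seq S c" "C = (\<lambda>n. \<pi> (c n))"
      by (rule quot_incr_seq_lift)
    then show "\<exists>A. is_seq_sup Q C A"
      using S.O1[OF c(1)] quot_map_sup[OF c(1)] by blast
  next
    fix A assume "A \<in> carrier Q"
    then obtain a where a: "a \<in> carrier S" "A = \<pi> a" by (rule quot_carrierE)
    obtain c where "incr_seq S c" "\<And>n. way_below S (c n) (c (Suc n))" "is_seq_sup S c a"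
      using S.way_below_approx[OF a(1)] by metis
    then show "\<exists>C. (\<forall>n. way_below Q (C n) (C (Suc n))) \<and> is_seq_sup Q C A"
      using quot_map_sup quot_map_way_below unfolding a(2)
      by (intro exI[of _ "\<lambda>n. \<pi> (c n)"]) simp
  next
    fix A' A B' B assume wb: "way_below Q A' A" "way_below Q B' B"
    obtain a where a: "a \<in> carrier S" "A = \<pi> a"
      using way_below_carrier_right[OF wb(1)] by (rule quot_carrierE)
    obtain b where b: "b \<in> carrier S" "B = \<pi> b"
      using way_below_carrier_right[OF wb(2)] by (rule quot_carrierE)
    obtain a' where a': "way_below S a' a" "A' \<sqsubseteq>\<^bsub>Q\<^esub> \<pi> a'"
      using quot_way_below_lift[OF wb(1)[unfolded a(2)] a(1)] .
    obtain b' where b': "way_below S b' b" "B' \<sqsubseteq>\<^bsub>Q\<^esub> \<pi> b'"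
      using quot_way_below_lift[OF wb(2)[unfolded b(2)] b(1)] .
    note [simp] = way_below_carrier_left[OF a'(1)] way_below_carrier_left[OF b'(1)]
      way_below_carrier_left[OF wb(1)] way_below_carrier_left[OF wb(2)]
    have "way_below Q (\<pi> a' \<oplus>\<^bsub>Q\<^esub> \<pi> b') (A \<oplus>\<^bsub>Q\<^esub> B)"
      using quot_map_way_below[OF S.O3[OF a'(1) b'(1)]] a b by (simp add: quot_plus)
    moreover have "A' \<oplus>\<^bsub>Q\<^esub> B' \<sqsubseteq>\<^bsub>Q\<^esub> \<pi> a' \<oplus>\<^bsub>Q\<^esub> \<pi> b'"
      using a'(2) b'(2) by (simp add: Q.add_mono)
    ultimately show "way_below Q (A' \<oplus>\<^bsub>Q\<^esub> B') (A \<oplus>\<^bsub>Q\<^esub> B)"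
      by (simp add: Q.le_way_below_trans)
  next
    fix C D A B assume C: "incr_seq Q C" "is_seq_sup Q C A" and D: "incr_seq Q D" "is_seq_sup Q D B"
    obtain c a where c: "incr_seq S c" "is_seq_sup S c a" "C = (\<lambda>n. \<pi> (c n))" "A = \<pi> a"
      using quot_sup_lift[OF C] .
    obtain d b where d: "incr_seq S d" "is_seq_sup S d b" "D = (\<lambda>n. \<pi> (d n))" "B = \<pi> b"
      using quot_sup_lift[OF D] .
    show "is_seq_sup Q (\<lambda>n. C n \<oplus>\<^bsub>Q\<^esub> D n) (A \<oplus>\<^bsub>Q\<^esub> B)"
      using quot_map_sup[OF S.incr_seq_plus[OF c(1) d(1)] S.O4[OF c(1) d(1) c(2) d(2)]] c d
      by (simp add: quot_plus incr_seq_carrier[OF c(1)] incr_seq_carrier[OF d(1)]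
          seq_sup_carrier[OF c(1,2)] seq_sup_carrier[OF d(1,2)])
  qed
qed

lemma quot_map_gen_cu_mor: "\<pi> \<in> gen_cu_mor S Q"
  by (rule gen_cu_morI) (simp_all add: quot_plus quot_zero quot_map_mono quot_map_sup)

section \<open>Pulling back along the quotient map\<close>

sublocale QT: cu_pair Q T
  by (intro cu_pair.intro quot_cu_semigroup T.cu_semigroup_axioms)

abbreviation pull :: "(rat \<Rightarrow> 'a set \<Rightarrow> 'b) \<Rightarrow> rat \<Rightarrow> 'a \<Rightarrow> 'b" where
  "pull f \<equiv> (\<lambda>l. f l \<circ> \<pi>)"

text \<open>To descend, enlarge \<open>A\<close> to \<open>\<pi> a\<close> with
  \<open>a \<lless> b\<close> and \<open>B = \<pi> b\<close>; monotonicity of \<open>f\<close> pays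
  for the enlargement. The converse is preservation of way-below by \<open>\<pi>\<close>.\<close>

lemma mor_prec_quot_iff:
  assumes f: "f \<in> gen_cu_mor Q T" and g: "g \<in> gen_cu_mor Q T"
  shows "mor_prec S T (f \<circ> \<pi>) (g \<circ> \<pi>) \<longleftrightarrow> mor_prec Q T f g"
proof
  assume fg: "mor_prec S T (f \<circ> \<pi>) (g \<circ> \<pi>)"
  show "mor_prec Q T f g"
  proof (rule mor_precI)
    fix A B assume AB: "way_below Q A B"
    obtain b where b: "b \<in> carrier S" "B = \<pi> b"
      using way_below_carrier_right[OF AB] by (rule quot_carrierE)
    obtain a where a: "way_below S a b" "A \<sqsubseteq>\<^bsub>Q\<^esub> \<pi> a"
      using quot_way_below_lift[OF AB[unfolded b(2)] b(1)] .
    note A = way_below_carrier_left[OF AB]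
    have "f A \<sqsubseteq>\<^bsub>T\<^esub> f (\<pi> a)"
      using gen_cu_mor_mono[OF f A _ a(2)] way_below_carrier_left[OF a(1)] by simp
    moreover have "way_below T (f (\<pi> a)) (g B)"
      using mor_precD[OF fg a(1)] b(2) by simp
    ultimately show "way_below T (f A) (g B)"
      using T.le_way_below_trans gen_cu_mor_closed[OF f A] by blast
  qed
next
  assume "mor_prec Q T f g"
  then show "mor_prec S T (f \<circ> \<pi>) (g \<circ> \<pi>)"
    using quot_map_way_below by (simp add: mor_prec_def)
qed

lemma pull_cu_paths:
  assumes f: "f \<in> cu_paths Q T"
  shows "pull f \<in> cu_paths S T"
proof (rule cu_pathsI)
  show "f l \<circ> \<pi> \<in> gen_cu_mor S T" if "l \<in> I_Q" for l
    using gen_cu_mor_comp[OF quot_map_gen_cu_mor cu_paths_mor[OF f that]] .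
  show "mor_prec S T (f l' \<circ> \<pi>) (f l \<circ> \<pi>)" if "l' \<in> I_Q" "l \<in> I_Q" "l' < l" for l' l
    using that mor_prec_quot_iff[OF cu_paths_mor[OF f] cu_paths_mor[OF f]] cu_paths_prec[OF f]
    by blast
qed

lemma path_le_pull_iff:
  assumes f: "f \<in> cu_paths Q T" and g: "g \<in> cu_paths Q T"
  shows "path_le S T (pull f) (pull g) \<longleftrightarrow> path_le Q T f g"
  unfolding path_le_def
  using mor_prec_quot_iff[OF cu_paths_mor[OF f] cu_paths_mor[OF g]] by blast

text \<open>Equivalent paths have equivalent pullbacks, so the union defining the pullback reduces
  to one class.\<close>

lemma quot_pullback_path_class:
  assumes f: "f \<in> cu_paths Q T"
  shows "quot_pullback S J T (path_class Q T f) = path_class S T (pull f)"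
proof -
  have "path_class S T (pull f') = path_class S T (pull f)" if "f' \<in> path_class Q T f" for f'
    using QT.path_class_memD[OF that] f
    by (simp add: path_class_eq_iff pull_cu_paths path_le_pull_iff)
  moreover have "path_class Q T f \<noteq> {}"
    using QT.path_class_mem[OF f] by blast
  ultimately show ?thesis
    by (simp add: quot_pullback_def hom_pullback_def cong: SUP_cong)
qed

lemma quot_pullback_closed:
  "x \<in> carrier (internal_hom Q T) \<Longrightarrow> quot_pullback S J T x \<in> carrier (internal_hom S T)"
  by (elim internal_hom_carrierE) (simp add: quot_pullback_path_class internal_hom_carrier pull_cu_paths)

lemma quot_pullback_le_iff:
  "\<lbrakk>x \<in> carrier (internal_hom Q T); y \<in> carrier (internal_hom Q T)\<rbrakk> \<Longrightarrow>
    quot_pullback S J T x \<sqsubseteq>\<^bsub>internal_hom S T\<^esub> quot_pullback S J T y \<longleftrightarrow> x \<sqsubseteq>\<^bsub>internal_hom Q T\<^esub> y"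
  by (elim internal_hom_carrierE)
    (simp add: quot_pullback_path_class internal_hom_le_iff QT.internal_hom_le_iff pull_cu_paths
      path_le_pull_iff)

lemma quot_pullback_plus:
  "\<lbrakk>x \<in> carrier (internal_hom Q T); y \<in> carrier (internal_hom Q T)\<rbrakk> \<Longrightarrow>
    quot_pullback S J T (x \<oplus>\<^bsub>internal_hom Q T\<^esub> y)
      = quot_pullback S J T x \<oplus>\<^bsub>internal_hom S T\<^esub> quot_pullback S J T y"
  by (elim internal_hom_carrierE)
    (simp add: quot_pullback_path_class internal_hom_plus QT.internal_hom_plus
      pull_cu_paths[unfolded comp_def] QT.plus_cu_paths comp_def)

lemma quot_pullback_zero:
  "quot_pullback S J T \<zero>\<^bsub>internal_hom Q T\<^esub> = \<zero>\<^bsub>internal_hom S T\<^esub>"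
  by (simp add: QT.internal_hom_zero internal_hom_zero quot_pullback_path_class QT.zero_cu_paths
      comp_def)

lemma order_embedding_quot_pullback:
  "order_embedding (internal_hom Q T) (internal_hom S T) (quot_pullback S J T)"
  by (simp add: order_embedding_def quot_pullback_closed quot_pullback_le_iff)

section \<open>Morphisms and paths vanishing on the ideal\<close>

lemma quot_map_ideal: "a \<in> J \<Longrightarrow> \<pi> a = \<zero>\<^bsub>Q\<^esub>"
  \<comment> \<open>The element \<open>a\<close> itself serves as its error term relative to
    zero.\<close>
  using ideal_leI[of a a "\<zero>\<^bsub>S\<^esub>"]
  by (simp add: quot_zero quot_map_eq_iff ideal_carrier le_imp_ideal_le S.zero_least)

text \<open>Error terms are sent to zero, so \<open>g\<close> is monotone for
  \<open>ideal_le\<close>; antisymmetry in \<open>T\<close> then makes its value independent of the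
  representative.\<close>

lemma vanishing_descends:
  assumes g: "g \<in> gen_cu_mor S T" and v: "vanishes_on T J g"
  obtains f where "f \<in> gen_cu_mor Q T" "\<And>a. a \<in> carrier S \<Longrightarrow> f (\<pi> a) = g a"
proof -
  \<comment> \<open>An arbitrary representative is chosen; values at sets that are not classes are
    irrelevant.\<close>
  define f where "f A = g (SOME a. a \<in> A)" for A
  have g_le: "g a \<sqsubseteq>\<^bsub>T\<^esub> g b" if le: "ideal_le S J a b" and [simp]: "a \<in> carrier S" "b \<in> carrier S" for a b
  proof -
    obtain c where c: "c \<in> J" "a \<sqsubseteq>\<^bsub>S\<^esub> b \<oplus>\<^bsub>S\<^esub> c" using le by (auto simp: ideal_le_def)
    have "g a \<sqsubseteq>\<^bsub>T\<^esub> g (b \<oplus>\<^bsub>S\<^esub> c)"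
      using c by (intro gen_cu_mor_mono[OF g]) (simp_all add: ideal_carrier)
    also have "g (b \<oplus>\<^bsub>S\<^esub> c) = g b"
      using c(1) v by (simp add: gen_cu_morD[OF g] ideal_carrier vanishes_on_def)
    finally show ?thesis .
  qed
  have f: "f (\<pi> a) = g a" if a: "a \<in> carrier S" for a
  proof -
    have "(SOME b. b \<in> \<pi> a) \<in> \<pi> a"
      using quot_map_self[OF a] by (rule someI)
    then show ?thesis
      unfolding f_def using a g_le quot_map_memD gen_cu_mor_closed[OF g] T.le_antisym by metis
  qed
  have "f \<in> gen_cu_mor Q T"
  proof (rule gen_cu_morI)
    show "f A \<in> carrier T" if "A \<in> carrier Q" for A
      using that by (elim quot_carrierE) (simp add: f gen_cu_mor_closed[OF g])
    show "f (A \<oplus>\<^bsub>Q\<^esub> B) = f A \<oplus>\<^bsub>T\<^esub> f B" if "A \<in> carrier Q" "B \<in> carrier Q" for A B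
      using that by (elim quot_carrierE) (simp add: f quot_plus gen_cu_mor_plus[OF g])
    show "f \<zero>\<^bsub>Q\<^esub> = \<zero>\<^bsub>T\<^esub>"
      by (simp add: quot_zero f gen_cu_mor_zero[OF g])
    show "f A \<sqsubseteq>\<^bsub>T\<^esub> f B" if "A \<in> carrier Q" "B \<in> carrier Q" "A \<sqsubseteq>\<^bsub>Q\<^esub> B" for A B
      using that by (elim quot_carrierE) (simp add: f quot_le_iff g_le)
    \<comment> \<open>Preservation of suprema needs the sequence and its supremum to lift together
      to \<open>S\<close>.\<close>
    fix C A assume "incr_seq Q C" "is_seq_sup Q C A"
    then obtain c s where "incr_seq S c" "is_seq_sup S c s" "C = (\<lambda>n. \<pi> (c n))" "A = \<pi> s"
      by (rule quot_sup_lift)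
    then show "is_seq_sup T (\<lambda>n. f (C n)) (f A)"
      using gen_cu_mor_sup[OF g] by (simp add: f incr_seq_carrier seq_sup_carrier)
  qed
  then show thesis using that f by blast
qed

text \<open>Way-below pairs lie in the carrier. This is used for descended maps, whose composition
  with \<open>\<pi>\<close> is known to agree with the original only there.\<close>

lemma mor_prec_cong:
  assumes "\<And>a. a \<in> carrier S \<Longrightarrow> f a = f' a" "\<And>a. a \<in> carrier S \<Longrightarrow> g a = g' a"
  shows "mor_prec S T f g \<longleftrightarrow> mor_prec S T f' g'"
  unfolding mor_prec_def
  using assms way_below_carrier_left[of S] way_below_carrier_right[of S] by metis

definition vanishing_paths :: "(rat \<Rightarrow> 'a \<Rightarrow> 'b) set" where
  "vanishing_paths = {f \<in> cu_paths S T. \<forall>l\<in>I_Q. vanishes_on T J (f l)}"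

lemma pull_vanishing:
  assumes f: "f \<in> cu_paths Q T"
  shows "pull f \<in> vanishing_paths"
  using pull_cu_paths[OF f] gen_cu_mor_zero[OF cu_paths_mor[OF f]]
  by (simp add: vanishing_paths_def vanishes_on_def quot_map_ideal)

text \<open>Each level descends separately, and \<open>mor_prec_quot_iff\<close> turns the results
  into a path. Agreement on the carrier gives equality of classes rather than of functions.\<close>

lemma vanishing_path_descends:
  assumes g: "g \<in> vanishing_paths"
  obtains f where "f \<in> cu_paths Q T" "path_class S T (pull f) = path_class S T g"
proof -
  have gp: "g \<in> cu_paths S T" and gv: "\<And>l. l \<in> I_Q \<Longrightarrow> vanishes_on T J (g l)"
    using g by (simp_all add: vanishing_paths_def)
  have "\<forall>l\<in>I_Q. \<exists>f. f \<in> gen_cu_mor Q T \<and> (\<forall>a\<in>carrier S. f (\<pi> a) = g l a)"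
    using vanishing_descends[OF cu_paths_mor[OF gp] gv] by metis
  then obtain f where f: "\<And>l. l \<in> I_Q \<Longrightarrow> f l \<in> gen_cu_mor Q T"
    "\<And>l a. \<lbrakk>l \<in> I_Q; a \<in> carrier S\<rbrakk> \<Longrightarrow> f l (\<pi> a) = g l a" by metis
  have prec: "mor_prec S T (f l \<circ> \<pi>) (f m \<circ> \<pi>) \<longleftrightarrow> mor_prec S T (g l) (g m)"
    "mor_prec S T (f l \<circ> \<pi>) (g m) \<longleftrightarrow> mor_prec S T (g l) (g m)"
    "mor_prec S T (g l) (f m \<circ> \<pi>) \<longleftrightarrow> mor_prec S T (g l) (g m)" if "l \<in> I_Q" "m \<in> I_Q" for l m
    using that f(2) by (intro mor_prec_cong; simp)+
  have fp: "f \<in> cu_paths Q T"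
  proof (rule cu_pathsI)
    show "mor_prec Q T (f l') (f l)" if "l' \<in> I_Q" "l \<in> I_Q" "l' < l" for l' l
      using that prec(1) cu_paths_prec[OF gp that] mor_prec_quot_iff[OF f(1) f(1)] by blast
  qed (rule f(1))
  \<comment> \<open>Reflexivity of \<open>path_le\<close> at \<open>g\<close> is transferred along
    the agreement on the carrier.\<close>
  have "path_le S T (pull f) g" "path_le S T g (pull f)"
    using path_le_refl[OF gp] prec(2,3) unfolding path_le_def by blast+
  then show thesis
    using that[OF fp] by (simp add: path_class_eq_iff pull_cu_paths[OF fp] gp)
qed

text \<open>The relation \<prec> implies the pointwise order, and an element below zero is zero by
  positivity. In particular, vanishing does not depend on the representing path.\<close>

lemma vanishing_paths_downward:
  assumes le: "path_le S T f g" and f: "f \<in> cu_paths S T" and g: "g \<in> vanishing_paths"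
  shows "f \<in> vanishing_paths"
proof -
  have gp: "g \<in> cu_paths S T" using g by (simp add: vanishing_paths_def)
  have "f l a = \<zero>\<^bsub>T\<^esub>" if l: "l \<in> I_Q" and a: "a \<in> J" for l a
  proof -
    obtain m where m: "m \<in> I_Q" "mor_prec S T (f l) (g m)" using path_leE[OF le l] .
    have "f l a \<sqsubseteq>\<^bsub>T\<^esub> g m a"
      using mor_prec_le[OF cu_paths_mor[OF f l] cu_paths_mor[OF gp m(1)] m(2)] ideal_carrier[OF a] .
    moreover have "g m a = \<zero>\<^bsub>T\<^esub>"
      using g m(1) a by (simp add: vanishing_paths_def vanishes_on_def)
    moreover have "f l a \<in> carrier T"
      using gen_cu_mor_closed[OF cu_paths_mor[OF f l] ideal_carrier[OF a]] .
    ultimately show ?thesis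
      using T.zero_least by (intro T.le_antisym) simp_all
  qed
  then show ?thesis using f by (simp add: vanishing_paths_def vanishes_on_def)
qed

section \<open>The image of the pullback as an ideal, and preservation of structure\<close>

abbreviation pullback_image :: "(rat \<Rightarrow> 'a \<Rightarrow> 'b) set set" where
  "pullback_image \<equiv> quot_pullback S J T ` carrier (internal_hom Q T)"

lemma pullback_image_eq: "pullback_image = path_class S T ` vanishing_paths"
proof
  show "pullback_image \<subseteq> path_class S T ` vanishing_paths"
    using pull_vanishing
    by (auto simp: internal_hom_carrier quot_pullback_path_class simp del: o_apply)
  show "path_class S T ` vanishing_paths \<subseteq> pullback_image"
  proof clarify
    fix g assume "g \<in> vanishing_paths"
    then obtain f where f: "f \<in> cu_paths Q T" "path_class S T (pull f) = path_class S T g"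
      by (rule vanishing_path_descends)
    have "quot_pullback S J T (path_class Q T f) = path_class S T g"
      using f by (simp add: quot_pullback_path_class)
    moreover have "path_class Q T f \<in> carrier (internal_hom Q T)"
      using f(1) by (simp add: internal_hom_carrier)
    ultimately show "path_class S T g \<in> pullback_image" by (metis imageI)
  qed
qed

text \<open>If the class has one vanishing representative, then \<open>f\<close> is below it and so
  vanishes too. Hence the conditions for some and for every representative agree.\<close>

lemma path_class_in_pullback_image_iff:
  assumes f: "f \<in> cu_paths S T"
  shows "path_class S T f \<in> pullback_image \<longleftrightarrow> (\<forall>l\<in>I_Q. vanishes_on T J (f l))"
proof
  assume "path_class S T f \<in> pullback_image"
  then obtain g where g: "g \<in> vanishing_paths" "path_class S T f = path_class S T g"
    unfolding pullback_image_eq by blast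
  then have "path_le S T f g"
    using path_class_eq_iff[OF f, of g] by (simp add: vanishing_paths_def)
  then have "f \<in> vanishing_paths" using vanishing_paths_downward f g(1) by blast
  then show "\<forall>l\<in>I_Q. vanishes_on T J (f l)" by (simp add: vanishing_paths_def)
next
  assume "\<forall>l\<in>I_Q. vanishes_on T J (f l)"
  then show "path_class S T f \<in> pullback_image"
    unfolding pullback_image_eq using f by (simp add: vanishing_paths_def)
qed

lemma pullback_image_downward:
  assumes x: "x \<in> carrier (internal_hom S T)" and y: "y \<in> pullback_image" and le: "x \<sqsubseteq>\<^bsub>internal_hom S T\<^esub> y"
  shows "x \<in> pullback_image"
proof -
  obtain f where f: "f \<in> cu_paths S T" "x = path_class S T f"
    using x by (rule internal_hom_carrierE)
  obtain g where g: "g \<in> vanishing_paths" "y = path_class S T g"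
    using y unfolding pullback_image_eq by blast
  have "path_le S T f g"
    using le f g by (simp add: internal_hom_le_iff vanishing_paths_def)
  then show ?thesis
    unfolding pullback_image_eq using f g vanishing_paths_downward by blast
qed

text \<open>Each member of the glued path \<open>h\<close> is a member of some \<open>F n\<close>,
  and all of those vanish on \<open>J\<close>.\<close>

lemma pullback_image_sup:
  assumes c: "incr_seq (internal_hom S T) c" "is_seq_sup (internal_hom S T) c s"
    and im: "range c \<subseteq> pullback_image"
  shows "s \<in> pullback_image"
proof -
  obtain F where F: "\<And>n. F n \<in> cu_paths S T" "\<And>n. c n = path_class S T (F n)"
    "\<And>n. path_le S T (F n) (F (Suc n))" using internal_hom_incr_seqE[OF c(1)] by blast
  obtain h where h: "h \<in> cu_paths S T" "\<And>l. l \<in> I_Q \<Longrightarrow> \<exists>n. \<exists>m\<in>I_Q. h l = F n m"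
    "is_seq_sup (internal_hom S T) (\<lambda>n. path_class S T (F n)) (path_class S T h)"
    using internal_hom_sup[of F, OF F(1,3)] by blast
  have c_eq: "c = (\<lambda>n. path_class S T (F n))" using F(2) by blast
  have "\<forall>l\<in>I_Q. vanishes_on T J (F n l)" for n
    using im path_class_in_pullback_image_iff[OF F(1), of n] by (auto simp: c_eq)
  then have "\<forall>l\<in>I_Q. vanishes_on T J (h l)" using h(2) by metis
  then have "path_class S T h \<in> pullback_image" using path_class_in_pullback_image_iff[OF h(1)] by blast
  \<comment> \<open>Only this inequality is required, because the image is downward
    hereditary.\<close>
  moreover have "s \<sqsubseteq>\<^bsub>internal_hom S T\<^esub> path_class S T h"
    using seq_sup_least[OF c] h(3) seq_sup_carrier seq_sup_upper c(1) unfolding c_eq by metis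
  ultimately show ?thesis using pullback_image_downward seq_sup_carrier[OF c] by blast
qed

lemma cu_ideal_pullback_image: "cu_ideal (internal_hom S T) pullback_image"
  unfolding cu_ideal_def
proof (intro conjI allI impI ballI)
  show "submonoid pullback_image (additive (internal_hom S T))"
  proof
    show "pullback_image \<subseteq> carrier (additive (internal_hom S T))"
      using quot_pullback_closed by (auto simp: additive_def)
    show "\<one>\<^bsub>additive (internal_hom S T)\<^esub> \<in> pullback_image"
      using quot_pullback_zero QT.internal_hom_zero_closed by (simp add: additive_def) (metis imageI)
    fix x y assume "x \<in> pullback_image" "y \<in> pullback_image"
    then show "x \<otimes>\<^bsub>additive (internal_hom S T)\<^esub> y \<in> pullback_image"
      using QT.internal_hom_plus_closed
      by (auto simp: additive_def quot_pullback_plus[symmetric])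
  qed
qed (use pullback_image_sup pullback_image_downward in blast)+

text \<open>The supremum in the larger internal hom lies below the image of the smaller one's
  supremum, hence in the image, so the two suprema agree.\<close>

lemma quot_pullback_sup:
  assumes c: "incr_seq (internal_hom Q T) c" "is_seq_sup (internal_hom Q T) c s"
  shows "is_seq_sup (internal_hom S T) (\<lambda>n. quot_pullback S J T (c n)) (quot_pullback S J T s)"
proof -
  note cc = incr_seq_carrier[OF c(1)] and sc = seq_sup_carrier[OF c]
  have incr: "incr_seq (internal_hom S T) (\<lambda>n. quot_pullback S J T (c n))"
    using incr_seq_Suc[OF c(1)] cc
    by (simp add: incr_seq_def quot_pullback_closed quot_pullback_le_iff)
  have ub: "quot_pullback S J T (c n) \<sqsubseteq>\<^bsub>internal_hom S T\<^esub> quot_pullback S J T s" for n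
    using seq_sup_upper[OF c] cc sc by (simp add: quot_pullback_le_iff)
  obtain F where F: "\<And>n. F n \<in> cu_paths S T" "\<And>n. quot_pullback S J T (c n) = path_class S T (F n)"
    "\<And>n. path_le S T (F n) (F (Suc n))" using internal_hom_incr_seqE[OF incr] by blast
  obtain y where y: "is_seq_sup (internal_hom S T) (\<lambda>n. quot_pullback S J T (c n)) y"
    using internal_hom_sup[of F, OF F(1,3)] unfolding F(2) by blast
  have yc: "y \<in> carrier (internal_hom S T)" using seq_sup_carrier[OF incr y] .
  have y_le: "y \<sqsubseteq>\<^bsub>internal_hom S T\<^esub> quot_pullback S J T s"
    using seq_sup_least[OF incr y quot_pullback_closed[OF sc] ub] .
  then obtain z where z: "z \<in> carrier (internal_hom Q T)" "y = quot_pullback S J T z"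
    using pullback_image_downward[OF yc _ y_le] sc by blast
  have "c n \<sqsubseteq>\<^bsub>internal_hom Q T\<^esub> z" for n
    using seq_sup_upper[OF incr y, of n] cc z by (simp add: quot_pullback_le_iff)
  then have "quot_pullback S J T s \<sqsubseteq>\<^bsub>internal_hom S T\<^esub> y"
    using seq_sup_least[OF c z(1)] z sc by (simp add: quot_pullback_le_iff)
  then have "y = quot_pullback S J T s"
    using y_le yc quot_pullback_closed[OF sc] internal_hom_le_antisym by blast
  then show ?thesis using y by simp
qed

text \<open>A truncation of a representative \<open>g\<close> of \<open>y\<close> dominates
  \<open>x\<close>. Pulling it back gives the truncation of \<open>pull g\<close> at the same level,
  which is way below the pullback of \<open>y\<close>.\<close>

lemma quot_pullback_way_below:
  assumes xy: "way_below (internal_hom Q T) x y"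
  shows "way_below (internal_hom S T) (quot_pullback S J T x) (quot_pullback S J T y)"
proof -
  obtain g where g: "g \<in> cu_paths Q T" "y = path_class Q T g"
    using way_below_carrier_right[OF xy] by (rule internal_hom_carrierE)
  obtain m where m: "m \<in> I_Q" "x \<sqsubseteq>\<^bsub>internal_hom Q T\<^esub> path_class Q T (\<lambda>l. g (m * l))"
    using QT.way_below_cut_path[OF xy[unfolded g(2)] g(1)] .
  note cut = QT.cut_cu_paths[OF g(1) m(1)]
  have x: "x \<in> carrier (internal_hom Q T)" using way_below_carrier_left[OF xy] .
  have le: "quot_pullback S J T x \<sqsubseteq>\<^bsub>internal_hom S T\<^esub> path_class S T (\<lambda>l. pull g (m * l))"
    using m(2) x cut quot_pullback_le_iff[OF x, of "path_class Q T (\<lambda>l. g (m * l))"]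
    by (simp add: quot_pullback_path_class[OF cut] internal_hom_carrier)
  have wb: "way_below (internal_hom S T) (path_class S T (\<lambda>l. pull g (m * l)))
      (quot_pullback S J T y)"
    unfolding g(2) quot_pullback_path_class[OF g(1)]
    by (rule cut_path_way_below[OF pull_cu_paths[OF g(1)] m(1)])
  show ?thesis
  proof (rule way_belowI)
    fix c s assume "incr_seq (internal_hom S T) c" "is_seq_sup (internal_hom S T) c s"
      "quot_pullback S J T y \<sqsubseteq>\<^bsub>internal_hom S T\<^esub> s"
    then obtain k where "path_class S T (\<lambda>l. pull g (m * l)) \<sqsubseteq>\<^bsub>internal_hom S T\<^esub> c k"
      "c k \<in> carrier (internal_hom S T)"
      using way_belowD[OF wb] incr_seq_carrier by metis
    then show "\<exists>k. quot_pullback S J T x \<sqsubseteq>\<^bsub>internal_hom S T\<^esub> c k"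
      using internal_hom_le_trans[OF le] way_below_carrier_left[OF wb] quot_pullback_closed[OF x]
      by blast
  qed (use quot_pullback_closed[OF x] way_below_carrier_right[OF wb] in blast)+
qed

lemma quot_pullback_cu_mor: "quot_pullback S J T \<in> cu_mor (internal_hom Q T) (internal_hom S T)"
proof -
  have "quot_pullback S J T \<in> gen_cu_mor (internal_hom Q T) (internal_hom S T)"
    by (rule gen_cu_morI)
      (simp_all add: quot_pullback_closed quot_pullback_plus quot_pullback_zero
        quot_pullback_le_iff quot_pullback_sup)
  then show ?thesis by (simp add: cu_mor_def quot_pullback_way_below)
qed

end

theorem proposition4p5:
  fixes S :: "('a, 'm) ordered_semigroup_scheme"
    and T :: "('b, 'n) ordered_semigroup_scheme"
    and J :: "'a set"
  assumes "cu_semigroup S" and "cu_semigroup T" and "cu_ideal S J"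
  shows "quot_pullback S J T \<in> cu_mor (internal_hom (cu_quot S J) T) (internal_hom S T)
    \<and> order_embedding (internal_hom (cu_quot S J) T) (internal_hom S T) (quot_pullback S J T)
    \<and> cu_ideal (internal_hom S T) (quot_pullback S J T ` carrier (internal_hom (cu_quot S J) T))
    \<and> (\<forall>x\<in>carrier (internal_hom S T).
        (x \<in> quot_pullback S J T ` carrier (internal_hom (cu_quot S J) T) \<longleftrightarrow>
          (\<exists>f\<in>cu_paths S T. path_class S T f = x \<and> (\<forall>l\<in>I_Q. vanishes_on T J (f l)))) \<and>
        (x \<in> quot_pullback S J T ` carrier (internal_hom (cu_quot S J) T) \<longleftrightarrow>
          (\<forall>f\<in>cu_paths S T. path_class S T f = x \<longrightarrow> (\<forall>l\<in>I_Q. vanishes_on T J (f l)))))"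
proof -
  interpret cu_ideal_pair S T J
    using assms by (simp add: cu_ideal_pair_def cu_ideal_pair_axioms_def cu_pair_def)
  have "(x \<in> pullback_image \<longleftrightarrow>
      (\<exists>f\<in>cu_paths S T. path_class S T f = x \<and> (\<forall>l\<in>I_Q. vanishes_on T J (f l)))) \<and>
    (x \<in> pullback_image \<longleftrightarrow>
      (\<forall>f\<in>cu_paths S T. path_class S T f = x \<longrightarrow> (\<forall>l\<in>I_Q. vanishes_on T J (f l))))"
    if x: "x \<in> carrier (internal_hom S T)" for x
  proof -
    obtain f where "f \<in> cu_paths S T" "x = path_class S T f"
      using x by (rule internal_hom_carrierE)
    \<comment> \<open>The criterion holds for every representative and at least one exists, so both
      quantified conditions reduce to it.\<close>
    then show ?thesis using path_class_in_pullback_image_iff by metis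
  qed
  then show ?thesis
    by (intro conjI[OF quot_pullback_cu_mor conjI[OF order_embedding_quot_pullback
            conjI[OF cu_ideal_pullback_image]]] ballI)
qed

end
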